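(* Let $p\in(0,1)$, $0<\lambda<1$, and let $f\in\mathcal{V}_p(\lambda)$ have the expansion $f(z)=z+\sum_{n=2}^\infty a_nz^n$ for $|z|<p$, with $U_f\not\equiv 0$. Then $f$ has a $\lambda$-quasiconformal extension onto $\widehat{\mathbb{C}}$, given by $$F(z)=\begin{cases}\dfrac{z}{1-a_2z+\phi(z)}, & |z|<1,\\[2mm] \dfrac{z}{1-a_2z+|z|^2\phi(1/\overline{z})}, & |z|\ge 1,\end{cases}$$ where $\phi(z)=z/f(z)+a_2z-1$ for $z\in\mathbb{D}$ (so that $f(z)=z/(1-a_2z+\phi(z))$ on $\mathbb{D}$ and $\phi(0)=\phi'(0)=0$).
   Context: $\mathbb{D}=\{z\in\mathbb{C}:|z|<1\}$, $\widehat{\mathbb{C}}=\mathbb{C}\cup\{\infty\}$. For $p\in(0,1)$, $\mathcal{A}(p)$ is the class of meromorphic functions $f$ on $\mathbb{D}$ that are analytic in $\mathbb{D}\setminus\{p\}$, have a simple pole (with nonzero residue) at $z=p$, and satisfy $f(0)=0=f'(0)-1$. For such $f$ put $U_f(z)=(z/f(z))^2f'(z)-1$, $z\in\mathbb{D}$ (with the removable singularities at $0$ and $p$ filled in; $z/f(z)$ has value $1$ at $0$ and $0$ at $p$). For $\lambda\in(0,1]$, $$\mathcal{V}_p(\lambda)=\{f\in\mathcal{A}(p): |U_f(z)|<\lambda \text{ for all } z\in\mathbb{D}\}$$ (in particular $U_f$ has no poles in $\mathbb{D}$, so $f$ has no zeros in $\mathbb{D}\setminus\{0\}$ and $z/f(z)$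 is analytic in $\mathbb{D}$). For $k\in[0,1)$, a $k$-quasiconformal mapping of $\widehat{\mathbb{C}}$ is a sense-preserving homeomorphism $F:\widehat{\mathbb{C}}\to\widehat{\mathbb{C}}$ belonging to the Sobolev space $W^{1,2}_{\mathrm{loc}}(\widehat{\mathbb{C}})$ with $|F_{\bar z}|\le k|F_z|$ a.e. A $k$-quasiconformal extension onto $\widehat{\mathbb{C}}$ of $f:\mathbb{D}\to\widehat{\mathbb{C}}$ is such an $F$ with $F|_{\mathbb{D}}=f$. Formulas for $F$ are read as maps into $\widehat{\mathbb{C}}$ (the value is $\infty$ where the denominator vanishes); the value at $z=\infty$, and values of $\phi$ on $|z|=1$, are understood by continuous extension. *)

theory Defs
  imports "HOL-Complex_Analysis.Complex_Analysis"
begin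

section \<open>The Riemann sphere\<close>

text \<open>
  The Riemann sphere is the one-point compactification of the complex plane:
  \<^term>\<open>Some z\<close> is the finite point \<open>z\<close>, and \<^term>\<open>None\<close> is the point at infinity.
\<close>

definition riemann_sphere :: "complex option topology" where
  "riemann_sphere = Alexandroff_compactification euclidean"

definition sphere_inv :: "complex option \<Rightarrow> complex option" where
  "sphere_inv w = (case w of None \<Rightarrow> Some 0 | Some z \<Rightarrow> if z = 0 then None else Some (inverse z))"

definition sphere_div :: "complex \<Rightarrow> complex \<Rightarrow> complex option" where
  "sphere_div a b = (if b = 0 then None else Some (a / b))"

text \<open>
  A meromorphic function in the library has an irrelevant complex value at a pole; this is the
  sphere-valued map that it represents.
\<close>

definition to_sphere :: "(complex \<Rightarrow> complex) \<Rightarrow> complex \<Rightarrow> complex option" where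
  "to_sphere f z = (if is_pole f z then None else Some (f z))"


section \<open>Local Sobolev functions on plane open sets\<close>

primrec Ck_plane :: "nat \<Rightarrow> (complex \<Rightarrow> real) \<Rightarrow> bool" where
  "Ck_plane 0 u \<longleftrightarrow> continuous_on UNIV u"
| "Ck_plane (Suc k) u \<longleftrightarrow>
     (\<forall>z. u differentiable (at z)) \<and>
     Ck_plane k (\<lambda>z. frechet_derivative u (at z) 1) \<and>
     Ck_plane k (\<lambda>z. frechet_derivative u (at z) \<i>)"

definition test_fun :: "complex set \<Rightarrow> (complex \<Rightarrow> real) \<Rightarrow> bool" where
  "test_fun \<Omega> u \<longleftrightarrow> (\<forall>k. Ck_plane k u) \<and>
     compact (closure {z. u z \<noteq> 0}) \<and> closure {z. u z \<noteq> 0} \<subseteq> \<Omega>"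

definition L2_loc :: "complex set \<Rightarrow> (complex \<Rightarrow> complex) \<Rightarrow> bool" where
  "L2_loc \<Omega> g \<longleftrightarrow> set_borel_measurable lborel \<Omega> g \<and>
     (\<forall>K. compact K \<and> K \<subseteq> \<Omega> \<longrightarrow> set_integrable lborel K (\<lambda>z. (cmod (g z))\<^sup>2))"

text \<open>\<open>h\<close> is the weak derivative of \<open>g\<close> on \<open>\<Omega>\<close> in the real direction \<open>v\<close>.\<close>

definition weak_partial ::
  "complex set \<Rightarrow> complex \<Rightarrow> (complex \<Rightarrow> complex) \<Rightarrow> (complex \<Rightarrow> complex) \<Rightarrow> bool" where
  "weak_partial \<Omega> v g h \<longleftrightarrow> (\<forall>u. test_fun \<Omega> u \<longrightarrow>
     (LINT z:\<Omega>|lborel. g z * of_real (frechet_derivative u (at z) v)) =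
     - (LINT z:\<Omega>|lborel. h z * of_real (u z)))"

text \<open>\<open>g\<close> lies in the local Sobolev space \<open>W\<^sup>1\<^sup>,\<^sup>2\<close> of \<open>\<Omega>\<close>, with weak partial derivatives \<open>gx\<close>, \<open>gy\<close>.\<close>

definition W12_loc_with ::
  "complex set \<Rightarrow> (complex \<Rightarrow> complex) \<Rightarrow> (complex \<Rightarrow> complex) \<Rightarrow> (complex \<Rightarrow> complex) \<Rightarrow> bool" where
  "W12_loc_with \<Omega> g gx gy \<longleftrightarrow> L2_loc \<Omega> g \<and> L2_loc \<Omega> gx \<and> L2_loc \<Omega> gy \<and>
     weak_partial \<Omega> 1 g gx \<and> weak_partial \<Omega> \<i> g gy"

text \<open>
  The two Wirtinger derivatives \<open>g\<^sub>z = (gx - i gy) / 2\<close> and \<open>(gx + i gy) / 2\<close> (with respect to the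
  conjugate variable) satisfy the distortion inequality almost everywhere.
\<close>

definition W12_dilatation_le :: "real \<Rightarrow> complex set \<Rightarrow> (complex \<Rightarrow> complex) \<Rightarrow> bool" where
  "W12_dilatation_le k \<Omega> g \<longleftrightarrow> (\<exists>gx gy. W12_loc_with \<Omega> g gx gy \<and>
     (AE z in lborel. z \<in> \<Omega> \<longrightarrow>
        cmod ((gx z + \<i> * gy z) / 2) \<le> k * cmod ((gx z - \<i> * gy z) / 2)))"

text \<open>
  For an injective continuous \<open>g\<close>, preserving the orientation means having local degree \<open>1\<close>: the
  image of a small positively oriented circle about \<open>z\<close> winds once around \<open>g z\<close>.
\<close>

definition sense_preserving_on :: "complex set \<Rightarrow> (complex \<Rightarrow> complex) \<Rightarrow> bool" where
  "sense_preserving_on \<Omega> g \<longleftrightarrow>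
     (\<forall>z\<in>\<Omega>. \<forall>\<^sub>F r in at_right 0. winding_number (g \<circ> circlepath z r) (g z) = 1)"


section \<open>Quasiconformal mappings of the sphere\<close>

text \<open>
  The coordinates \<open>z\<close> and \<open>1/z\<close> form a holomorphic atlas of the sphere. For
  \<open>S\<close>, \<open>T\<close> ranging over \<^term>\<open>id\<close> and \<^term>\<open>sphere_inv\<close>, the composition \<open>T \<circ> F \<circ> S\<close> restricted to the
  finite points with finite image is the expression of \<open>F\<close> in these coordinates.
\<close>

definition local_dom :: "(complex option \<Rightarrow> complex option) \<Rightarrow> complex set" where
  "local_dom G = {z. G (Some z) \<noteq> None}"

definition local_rep :: "(complex option \<Rightarrow> complex option) \<Rightarrow> complex \<Rightarrow> complex" where
  "local_rep G z = the (G (Some z))"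

definition sphere_quasiconformal :: "real \<Rightarrow> (complex option \<Rightarrow> complex option) \<Rightarrow> bool" where
  "sphere_quasiconformal k F \<longleftrightarrow> 0 \<le> k \<and> k < 1 \<and>
     homeomorphic_map riemann_sphere riemann_sphere F \<and>
     (\<forall>S\<in>{id, sphere_inv}. \<forall>T\<in>{id, sphere_inv}.
        sense_preserving_on (local_dom (T \<circ> F \<circ> S)) (local_rep (T \<circ> F \<circ> S)) \<and>
        W12_dilatation_le k (local_dom (T \<circ> F \<circ> S)) (local_rep (T \<circ> F \<circ> S)))"

definition is_qc_extension ::
  "real \<Rightarrow> (complex \<Rightarrow> complex) \<Rightarrow> (complex option \<Rightarrow> complex option) \<Rightarrow> bool" where
  "is_qc_extension k f F \<longleftrightarrow> sphere_quasiconformal k F \<and>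
     (\<forall>z\<in>ball 0 1. F (Some z) = to_sphere f z)"


section \<open>The function classes\<close>

definition class_A :: "real \<Rightarrow> (complex \<Rightarrow> complex) set" where
  "class_A p = {f. f meromorphic_on ball 0 1 \<and>
     f holomorphic_on (ball 0 1 - {of_real p}) \<and>
     is_pole f (of_real p) \<and> zorder f (of_real p) = -1 \<and>
     f 0 = 0 \<and> deriv f 0 - 1 = 0}"

definition U_op :: "(complex \<Rightarrow> complex) \<Rightarrow> complex \<Rightarrow> complex" where
  "U_op f = remove_sings (\<lambda>z. (z / f z)\<^sup>2 * deriv f z - 1)"

text \<open>
  If \<open>f\<close> vanished at a point of the disk other than \<open>0\<close>, then \<open>U_op f\<close> would have a pole there and
  be unbounded nearby, so the bound below also says that \<open>U_op f\<close> has no poles; the value \<open>0\<close>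
  that \<^const>\<open>remove_sings\<close> assigns to a pole does no harm.
\<close>

definition class_V :: "real \<Rightarrow> real \<Rightarrow> (complex \<Rightarrow> complex) set" where
  "class_V p lambda = {f \<in> class_A p. \<forall>z\<in>ball 0 1. cmod (U_op f z) < lambda}"


section \<open>The extension\<close>

definition phi :: "(complex \<Rightarrow> complex) \<Rightarrow> complex \<Rightarrow> complex \<Rightarrow> complex" where
  "phi f a2 z = remove_sings (\<lambda>w. w / f w) z + a2 * z - 1"

definition phi_bar :: "(complex \<Rightarrow> complex) \<Rightarrow> complex \<Rightarrow> complex \<Rightarrow> complex" where
  "phi_bar f a2 z = (if cmod z < 1 then phi f a2 z else Lim (at z within ball 0 1) (phi f a2))"

definition F_fin :: "(complex \<Rightarrow> complex) \<Rightarrow> complex \<Rightarrow> complex \<Rightarrow> complex option" where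
  "F_fin f a2 z =
     (if cmod z < 1 then sphere_div z (1 - a2 * z + phi f a2 z)
      else sphere_div z (1 - a2 * z + of_real ((cmod z)\<^sup>2) * phi_bar f a2 (1 / cnj z)))"

definition F_ext :: "(complex \<Rightarrow> complex) \<Rightarrow> complex \<Rightarrow> complex option \<Rightarrow> complex option" where
  "F_ext f a2 w = (case w of
       Some z \<Rightarrow> F_fin f a2 z
     | None \<Rightarrow> (THE l. limitin riemann_sphere (F_fin f a2) l at_infinity))"

end

(*
  Put g = z/f and psi(z) = (g(z) + a2 z - 1)/z, so that 1/f(z) = 1/z - a2 + psi(z) and
  psi' = -U_f/z^2. The maximum principle on circles |z| = r with r -> 1 gives |psi'| <= lambda,
  so psi is lambda-Lipschitz and extends continuously to the closed disk. In the coordinates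
  w = 1/z at the source and 1/F at the target the extension F is
  H(w) = w - a2 + psi(sigma(w)), where sigma(w) = conj(w) for |w| <= 1 and 1/w for |w| >= 1.
  Since sigma is 1-Lipschitz, H is the identity plus a lambda-contraction: Banach's fixed point
  theorem makes it bijective, a linear homotopy shows that it preserves the orientation, and it is
  locally Lipschitz, hence in W^{1,2}_loc with its classical derivatives away from the unit circle
  as weak derivatives. All these properties survive composition with 1/z on either side.
*)
theory Submission
  imports Defs
begin

section \<open>Weak derivatives of locally Lipschitz functions\<close>

text \<open>Passing to 1/F linearises the problem: the quotient defining F becomes a sum in which
  only the last term is nonlinear, and a zero of the denominator becomes a zero of \<open>H\<close>.
  The factor |z|^2 in the outer formula fits this: since phi(z) = z psi(z), the term |z|^2
  phi(1/conj z) is z psi(1/conj z). The constant lambda < 1 is then used twice, as the contraction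
  constant of the perturbation and as the bound for the ratio of the two Wirtinger derivatives of
  \<open>H\<close> inside the unit circle, where the derivative in w is 1. The obstacle is the unit
  circle: \<open>H\<close> may fail to be differentiable there, yet degree and Sobolev regularity
  are claimed at every point of four charts. Both follow from a Lipschitz estimate for G(y) - A y
  with constant below |A|, which needs no derivative at the point and is stable under composition
  with conformal maps. The only point that composition cannot reach is z = 0 in the coordinates z
  and F, since it corresponds to w = infinity; there F is the conformal map f itself.\<close>

lemma lborel_integral_translate:
  fixes k :: "'a::euclidean_space \<Rightarrow> 'b::{banach, second_countable_topology}"
  assumes "k \<in> borel_measurable borel"
  shows "integral\<^sup>L lborel (\<lambda>z. k (z + w)) = integral\<^sup>L lborel k"
proof -
  have "integral\<^sup>L lborel k = integral\<^sup>L (distr lborel borel ((+) w)) k"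
    by (simp add: lborel_distr_plus)
  also have "\<dots> = integral\<^sup>L lborel (\<lambda>z. k (w + z))"
    by (rule integral_distr) (use assms in auto)
  finally show ?thesis by (simp add: add.commute)
qed

text \<open>Translation invariance makes the integrals of all difference quotients vanish; the
  derivative is their dominated limit.\<close>

lemma integral_directional_derivative_eq_0:
  fixes k k' :: "'a::euclidean_space \<Rightarrow> 'b::{banach, second_countable_topology}"
  assumes int: "integrable lborel k"
    and k': "k' \<in> borel_measurable borel"
    and "compact C" and "\<delta> > 0"
    and lip: "\<And>z t. \<lbrakk>0 < t; t \<le> \<delta>; z \<in> C\<rbrakk> \<Longrightarrow> norm (k (z + t *\<^sub>R v) - k z) \<le> L * t"
    and supp: "\<And>z t. \<lbrakk>0 < t; t \<le> \<delta>; z \<notin> C\<rbrakk> \<Longrightarrow> k (z + t *\<^sub>R v) = k z"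
    and lim: "AE z in lborel. ((\<lambda>t. (k (z + t *\<^sub>R v) - k z) /\<^sub>R t) \<longlongrightarrow> k' z) (at_right 0)"
  shows "integral\<^sup>L lborel k' = 0"
proof -
  have [measurable]: "k \<in> borel_measurable borel" "k' \<in> borel_measurable borel" "C \<in> sets borel"
    using int k' \<open>compact C\<close> by (auto dest: borel_measurable_integrable intro: borel_compact)
  \<comment> \<open>Dominated convergence is applied along a sequence; dividing by
    \<open>Suc n\<close> keeps every step in (0, \<open>\<delta>\<close>].\<close>
  define t :: "nat \<Rightarrow> real" where "t n = \<delta> / (Suc n)" for n
  have t: "0 < t n" "t n \<le> \<delta>" for n
    using \<open>\<delta> > 0\<close> by (auto simp: t_def divide_simps)
  have "t \<longlonglongrightarrow> 0"
    unfolding t_def using LIMSEQ_Suc[OF lim_const_over_n[of \<delta>]] by simp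
  then have t_lim: "filterlim t (at_right 0) sequentially"
    using t(1) by (auto simp: filterlim_at intro!: always_eventually less_imp_neq[symmetric])
  define q where "q n z = (k (z + t n *\<^sub>R v) - k z) /\<^sub>R t n" for n z
  have shift_int: "integrable lborel (\<lambda>z. k (z + w))" for w
    using int integrable_distr_eq[of "(+) w" lborel borel k]
    by (simp add: lborel_distr_plus add.commute)
  have "integral\<^sup>L lborel (q n) = 0" for n
    unfolding q_def using int shift_int[of "t n *\<^sub>R v"]
    by (simp add: lborel_integral_translate)
  moreover have "(\<lambda>n. integral\<^sup>L lborel (q n)) \<longlonglongrightarrow> integral\<^sup>L lborel k'"
  proof (rule integral_dominated_convergence[where w = "\<lambda>z. \<bar>L\<bar> * indicator C z"])
    have "emeasure lborel C < \<infinity>"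
      using \<open>compact C\<close> emeasure_compact_finite by blast
    then show "integrable lborel (\<lambda>z. \<bar>L\<bar> * indicator C z :: real)"
      by (intro integrable_mult_right) (auto simp: integrable_indicator_iff)
    show "AE z in lborel. (\<lambda>n. q n z) \<longlonglongrightarrow> k' z"
      using lim by eventually_elim (auto simp: q_def intro: filterlim_compose[OF _ t_lim])
    show "AE z in lborel. norm (q n z) \<le> \<bar>L\<bar> * indicator C z" for n
    proof (rule AE_I2)
      fix z
      show "norm (q n z) \<le> \<bar>L\<bar> * indicator C z"
      proof (cases "z \<in> C")
        case True
        have "norm (k (z + t n *\<^sub>R v) - k z) \<le> \<bar>L\<bar> * t n"
          using lip[OF t[of n] True] t(1)[of n] by (smt (verit) mult_right_mono)
        then show ?thesis
          using True t(1)[of n] by (simp add: q_def divide_simps)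
      next
        case False
        then show ?thesis using supp[OF t[of n] False] by (simp add: q_def)
      qed
    qed
    show "q n \<in> borel_measurable lborel" for n
      unfolding q_def by measurable
  qed (use k' in simp)
  ultimately have "(\<lambda>_. 0) \<longlonglongrightarrow> integral\<^sup>L lborel k'"
    by simp
  then show ?thesis
    by (simp add: LIMSEQ_const_iff)
qed

text \<open>The ball is not intersected with \<open>S\<close>, so the function is controlled on a
  full neighbourhood of each point and is continuous there in the whole space.\<close>

definition locally_lipschitz :: "'a::metric_space set \<Rightarrow> ('a \<Rightarrow> 'b::metric_space) \<Rightarrow> bool" where
  "locally_lipschitz S f \<longleftrightarrow> (\<forall>x\<in>S. \<exists>e>0. \<exists>L. L-lipschitz_on (ball x e) f)"

lemma locally_lipschitz_imp_isCont:
  assumes "locally_lipschitz S f" and "x \<in> S"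
  shows "isCont f x"
proof -
  obtain e L where "e > 0" "L-lipschitz_on (ball x e) f"
    using assms by (auto simp: locally_lipschitz_def)
  then show ?thesis
    using lipschitz_on_continuous_on continuous_on_interior
    by (metis centre_in_ball interior_open open_ball)
qed

lemma locally_lipschitz_compact:
  assumes "locally_lipschitz S f" and "compact K" and "K \<subseteq> S"
  obtains L where "L-lipschitz_on K f"
proof -
  \<comment> \<open>\<open>local_lipschitz\<close> is a notion for time-dependent maps; a time set
    with one point makes its compactness theorem available, which glues the local constants although
    \<open>K\<close> need not be convex.\<close>
  have "local_lipschitz {0::real} K (\<lambda>_. f)"
    unfolding local_lipschitz_def
  proof (intro ballI)
    fix x t assume "x \<in> K"
    then obtain e L where "e > 0" "L-lipschitz_on (ball x e) f"
      using assms unfolding locally_lipschitz_def by blast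
    then show "\<exists>u>0. \<exists>L. \<forall>t\<in>cball t u \<inter> {0::real}. L-lipschitz_on (cball x u \<inter> K) f"
      by (intro exI[of _ "e / 2"] conjI exI[of _ L]) (auto intro: lipschitz_on_subset)
  qed
  then obtain L where "\<And>t. t \<in> {0::real} \<Longrightarrow> L-lipschitz_on K f"
    by (rule local_lipschitz_compact_implies_lipschitz[OF _ \<open>compact K\<close>])
      (auto intro: continuous_on_const)
  then show ?thesis by (rule that) simp
qed

text \<open>\<open>Ck_plane\<close> speaks only of the directions 1 and \<i>; real linearity of the
  derivative recovers all others.\<close>

lemma test_fun_derivative:
  assumes "test_fun \<Omega> u"
  shows "(u has_derivative (\<lambda>v. Re v * frechet_derivative u (at z) 1
           + Im v * frechet_derivative u (at z) \<i>)) (at z)"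
proof -
  have "Ck_plane 1 u"
    using assms by (simp add: test_fun_def)
  then have "(u has_derivative frechet_derivative u (at z)) (at z)"
    by (simp add: frechet_derivative_works)
  moreover have "frechet_derivative u (at z) = (\<lambda>v. Re v * frechet_derivative u (at z) 1
           + Im v * frechet_derivative u (at z) \<i>)" (is "?D = _")
  proof
    fix v
    interpret linear ?D
      using calculation by (rule has_derivative_linear)
    have "?D v = ?D (Re v *\<^sub>R 1 + Im v *\<^sub>R \<i>)"
      by (rule arg_cong[of _ _ ?D]) (simp add: complex_eq_iff)
    then show "?D v = Re v * ?D 1 + Im v * ?D \<i>"
      by (simp add: add scale)
  qed
  ultimately show ?thesis by simp
qed

lemma test_fun_continuous_derivative:
  assumes "test_fun \<Omega> u"
  shows "continuous_on UNIV (\<lambda>z. frechet_derivative u (at z) v)"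
proof -
  have "Ck_plane (Suc 0) u"
    using assms by (simp add: test_fun_def)
  then have c: "continuous_on UNIV (\<lambda>z. frechet_derivative u (at z) 1)"
    "continuous_on UNIV (\<lambda>z. frechet_derivative u (at z) \<i>)"
    by simp_all
  have "frechet_derivative u (at z) v = Re v * frechet_derivative u (at z) 1
           + Im v * frechet_derivative u (at z) \<i>" for z
    using frechet_derivative_at[OF test_fun_derivative[OF assms, of z]] by metis
  then show ?thesis
    by (simp, intro continuous_intros c)
qed

lemma test_fun_continuous:
  assumes "test_fun \<Omega> u"
  shows "continuous_on UNIV u"
  using assms by (metis test_fun_def Ck_plane.simps(1))

lemma test_fun_derivative_outside:
  assumes "z \<notin> closure {z. u z \<noteq> 0}"
  shows "frechet_derivative u (at z) = (\<lambda>_. 0)"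
proof -
  have "((\<lambda>_. 0) has_derivative (\<lambda>_. 0)) (at z)" by simp
  then have "(u has_derivative (\<lambda>_. 0)) (at z)"
  proof (rule has_derivative_transform_within_open)
    show "open (- closure {z. u z \<noteq> 0})" by auto
  qed (use assms closure_subset[of "{z. u z \<noteq> 0}"] in auto)
  then show ?thesis by (metis frechet_derivative_at)
qed

lemma continuous_compact_support_bounded:
  fixes w :: "'a::t2_space \<Rightarrow> 'b::real_normed_vector"
  assumes "continuous_on UNIV w" and "compact K" and "\<And>z. z \<notin> K \<Longrightarrow> w z = 0"
  obtains B where "B > 0" and "\<And>z. norm (w z) \<le> B"
proof -
  have "bounded (w ` K)"
    using assms by (intro compact_imp_bounded compact_continuous_image)
      (auto intro: continuous_on_subset)
  then obtain B where "\<And>z. z \<in> K \<Longrightarrow> norm (w z) \<le> B" "B > 0"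
    by (auto simp: bounded_pos)
  with assms(3) that show ?thesis
    by (metis norm_zero less_imp_le)
qed

text \<open>Both partial derivatives are continuous with compact support, hence bounded, and the sum
  of their bounds dominates the operator norm of the derivative.\<close>

lemma test_fun_lipschitz:
  assumes "test_fun \<Omega> u"
  obtains L where "L-lipschitz_on UNIV u"
proof -
  let ?K = "closure {z. u z \<noteq> 0}"
  have K: "compact ?K"
    using assms by (simp add: test_fun_def)
  have out: "frechet_derivative u (at z) v = 0" if "z \<notin> ?K" for z v
    using test_fun_derivative_outside[OF that] by simp
  obtain B1 where B1: "B1 > 0" "\<And>z. norm (frechet_derivative u (at z) 1) \<le> B1"
    using continuous_compact_support_bounded[OF test_fun_continuous_derivative[OF assms] K out]
    by metis
  obtain B2 where B2: "B2 > 0" "\<And>z. norm (frechet_derivative u (at z) \<i>) \<le> B2"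
    using continuous_compact_support_bounded[OF test_fun_continuous_derivative[OF assms] K out]
    by metis
  have "(B1 + B2)-lipschitz_on UNIV u"
  proof (rule bounded_derivative_imp_lipschitz[OF test_fun_derivative[OF assms]])
    fix z :: complex
    show "onorm (\<lambda>v. Re v * frechet_derivative u (at z) 1
           + Im v * frechet_derivative u (at z) \<i>) \<le> B1 + B2"
    proof (rule onorm_le)
      fix v
      have "norm (Re v * frechet_derivative u (at z) 1 + Im v * frechet_derivative u (at z) \<i>)
        \<le> \<bar>Re v\<bar> * norm (frechet_derivative u (at z) 1)
          + \<bar>Im v\<bar> * norm (frechet_derivative u (at z) \<i>)"
        by (intro norm_triangle_le) (simp add: abs_mult)
      also have "\<dots> \<le> norm v * B1 + norm v * B2"
        by (intro add_mono mult_mono B1 B2 abs_Re_le_cmod abs_Im_le_cmod) auto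
      finally show "norm (Re v * frechet_derivative u (at z) 1
           + Im v * frechet_derivative u (at z) \<i>) \<le> (B1 + B2) * norm v"
        by (simp add: algebra_simps)
    qed
  qed (use B1 B2 in auto)
  then show ?thesis by (rule that)
qed

text \<open>Provides room for difference quotients: points of \<open>K\<close> can be moved by up to
  \<open>\<delta>\<close> inside one compact subset of \<open>\<Omega>\<close>, on which a single
  Lipschitz constant is available.\<close>

lemma compact_neighbourhood:
  fixes K :: "'a::euclidean_space set"
  assumes "compact K" and "open \<Omega>" and "K \<subseteq> \<Omega>"
  obtains \<delta> K' where "\<delta> > 0" "compact K'" "K' \<subseteq> \<Omega>" "\<And>x. x \<in> K \<Longrightarrow> cball x \<delta> \<subseteq> K'"
proof -
  obtain \<delta> where \<delta>: "\<delta> > 0" "(\<Union>x\<in>K. cball x \<delta>) \<subseteq> \<Omega>"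
    using compact_subset_open_imp_cball_epsilon_subset[OF assms] by blast
  \<comment> \<open>As a Minkowski sum of two compact sets the neighbourhood is compact.\<close>
  have eq: "(\<Union>x\<in>K. cball x \<delta>) = (\<Union>x\<in>K. \<Union>y\<in>cball 0 \<delta>. {x + y})" (is "?A = ?B")
  proof
    have "y \<in> ?B" if "x \<in> K" "y \<in> cball x \<delta>" for x y
      proof (intro UN_I)
      show "x \<in> K" "y - x \<in> cball 0 \<delta>" "y \<in> {x + (y - x)}"
        using that by (auto simp: dist_norm norm_minus_commute)
    qed
    then show "?A \<subseteq> ?B" by blast
  qed (auto simp: dist_norm)
  have "compact (\<Union>x\<in>K. cball x \<delta>)"
    unfolding eq by (rule compact_sums') (use \<open>compact K\<close> in auto)
  with \<delta> that show ?thesis by blast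
qed

lemma integrable_bounded_compact_support:
  fixes w :: "'a::euclidean_space \<Rightarrow> 'b::{banach, second_countable_topology}"
  assumes "w \<in> borel_measurable borel" and "compact K"
    and "\<And>z. z \<in> K \<Longrightarrow> norm (w z) \<le> B" and "\<And>z. z \<notin> K \<Longrightarrow> w z = 0"
  shows "integrable lborel w"
proof (rule Bochner_Integration.integrable_bound)
  have "emeasure lborel K < \<infinity>"
    using \<open>compact K\<close> emeasure_compact_finite by blast
  then show "integrable lborel (\<lambda>z. \<bar>B\<bar> * indicator K z :: real)"
    using \<open>compact K\<close> by (intro integrable_mult_right) (auto simp: integrable_indicator_iff borel_compact)
  show "AE z in lborel. norm (w z) \<le> norm (\<bar>B\<bar> * indicator K z :: real)"
  proof (rule AE_I2)
    fix z
    show "norm (w z) \<le> norm (\<bar>B\<bar> * indicator K z :: real)"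
      using assms(3,4)[of z] by (cases "z \<in> K") auto
  qed
qed (use assms in simp)

lemma has_derivative_directional:
  fixes g :: "'a::real_normed_vector \<Rightarrow> 'b::real_normed_vector"
  assumes "(g has_derivative D) (at z)"
  shows "((\<lambda>t. (g (z + t *\<^sub>R v) - g z) /\<^sub>R t) \<longlongrightarrow> D v) (at_right 0)"
proof -
  interpret bounded_linear D using assms by (rule has_derivative_bounded_linear)
  have "((\<lambda>t. z + t *\<^sub>R v) has_derivative (\<lambda>t. t *\<^sub>R v)) (at_right (0::real))"
    by (auto intro!: derivative_eq_intros)
  moreover have "(g has_derivative D) (at (z + 0 *\<^sub>R v))"
    using assms by simp
  ultimately have "((\<lambda>t. g (z + t *\<^sub>R v)) has_derivative (\<lambda>t. D (t *\<^sub>R v))) (at_right 0)"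
    by (rule has_derivative_compose)
  then have "((\<lambda>t. (g (z + t *\<^sub>R v) - g z - t *\<^sub>R D v) /\<^sub>R norm t) \<longlongrightarrow> 0) (at_right 0)"
    by (simp add: has_derivative_within scaleR diff_diff_eq inverse_eq_divide)
  then have "((\<lambda>t. (g (z + t *\<^sub>R v) - g z - t *\<^sub>R D v) /\<^sub>R norm t + D v) \<longlongrightarrow> 0 + D v) (at_right 0)"
    by (intro tendsto_add tendsto_const)
  moreover have "\<forall>\<^sub>F t in at_right 0. (g (z + t *\<^sub>R v) - g z - t *\<^sub>R D v) /\<^sub>R norm t + D v
      = (g (z + t *\<^sub>R v) - g z) /\<^sub>R t"
    using eventually_at_right_less[of "0::real"]
    by eventually_elim (simp add: algebra_simps)
  ultimately show ?thesis
    by (simp add: filterlim_cong)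
qed

lemma L2_loc_bounded:
  assumes meas: "set_borel_measurable lborel \<Omega> h"
    and bdd: "\<And>K. \<lbrakk>compact K; K \<subseteq> \<Omega>\<rbrakk> \<Longrightarrow> \<exists>B. \<forall>z\<in>K. cmod (h z) \<le> B"
  shows "L2_loc \<Omega> h"
  unfolding L2_loc_def
proof (intro conjI allI impI meas)
  fix K assume K: "compact K \<and> K \<subseteq> \<Omega>"
  then obtain B where B: "\<forall>z\<in>K. cmod (h z) \<le> B" using bdd[of K] by auto
  have [measurable]: "K \<in> sets borel" using K by (auto intro: borel_compact)
  have [measurable]: "(\<lambda>z. indicator \<Omega> z *\<^sub>R h z) \<in> borel_measurable borel"
    using meas by (simp add: set_borel_measurable_def)
  \<comment> \<open>Measurability is known only for \<open>h\<close> cut off outside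
    \<open>\<Omega>\<close>; since \<open>K\<close> lies in \<open>\<Omega>\<close>, the cut-off
    changes nothing on \<open>K\<close>.\<close>
  have eq: "(\<lambda>z. indicator K z *\<^sub>R (cmod (h z))\<^sup>2)
      = (\<lambda>z. indicator K z *\<^sub>R (cmod (indicator \<Omega> z *\<^sub>R h z))\<^sup>2)"
    using K by (auto simp: fun_eq_iff indicator_def)
  have "(\<lambda>z. indicator K z *\<^sub>R (cmod (h z))\<^sup>2) \<in> borel_measurable borel"
    unfolding eq by measurable
  then show "set_integrable lborel K (\<lambda>z. (cmod (h z))\<^sup>2)"
    unfolding set_integrable_def
    by (rule integrable_bounded_compact_support[where K = K and B = "B\<^sup>2"])
      (use K B in \<open>auto intro!: power_mono\<close>)
qed

section \<open>Classical derivatives off a closed null set as weak derivatives\<close>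

context
  fixes \<Omega> N :: "complex set" and g :: "complex \<Rightarrow> complex" and D :: "complex \<Rightarrow> complex \<Rightarrow> complex"
  assumes open_dom: "open \<Omega>" and lip: "locally_lipschitz \<Omega> g"
    and closed_N: "closed N" and null_N: "N \<in> null_sets lborel"
    and deriv: "\<And>z. z \<in> \<Omega> - N \<Longrightarrow> (g has_derivative D z) (at z)"
begin

lemma borel_extension: "(\<lambda>z. indicator \<Omega> z *\<^sub>R g z) \<in> borel_measurable borel"
  using locally_lipschitz_imp_isCont[OF lip] open_dom
  by (intro borel_measurable_continuous_on_indicator)
    (auto simp: continuous_on_eq_continuous_at)

text \<open>Nothing is assumed about how \<open>D\<close> depends on the point; measurability comes
  from writing it as a pointwise limit of difference quotients of \<open>g\<close> extended by
  zero.\<close>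

lemma borel_partial: "(\<lambda>z. indicator (\<Omega> - N) z *\<^sub>R D z v) \<in> borel_measurable borel"
proof -
  define g0 where "g0 z = indicator \<Omega> z *\<^sub>R g z" for z
  have [measurable]: "g0 \<in> borel_measurable borel"
    using borel_extension by (simp add: g0_def[abs_def])
  have [measurable]: "\<Omega> \<in> sets borel" "N \<in> sets borel"
    using open_dom closed_N by auto
  define t :: "nat \<Rightarrow> real" where "t n = 1 / (Suc n)" for n
  have "t \<longlonglongrightarrow> 0"
    unfolding t_def using LIMSEQ_Suc[OF lim_const_over_n[of 1]] by simp
  then have t_lim: "filterlim t (at_right 0) sequentially"
    by (auto simp: filterlim_at t_def intro!: always_eventually)
  show ?thesis
  proof (rule borel_measurable_LIMSEQ_metric)
    show "(\<lambda>z. indicator (\<Omega> - N) z *\<^sub>R ((g0 (z + t n *\<^sub>R v) - g0 z) /\<^sub>R t n))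
        \<in> borel_measurable borel" for n
      by measurable
    show "(\<lambda>n. indicator (\<Omega> - N) z *\<^sub>R ((g0 (z + t n *\<^sub>R v) - g0 z) /\<^sub>R t n))
        \<longlonglongrightarrow> indicator (\<Omega> - N) z *\<^sub>R D z v" for z
    proof (cases "z \<in> \<Omega> - N")
      case True
      have "(g0 has_derivative D z) (at z)"
        by (rule has_derivative_transform_within_open[OF deriv[OF True] open_dom])
          (use True in \<open>auto simp: g0_def\<close>)
      from filterlim_compose[OF has_derivative_directional[OF this] t_lim] True
      show ?thesis by simp
    qed simp
  qed
qed

lemma bounded_partial:
  assumes "compact K" and "K \<subseteq> \<Omega>"
  shows "\<exists>B. \<forall>z\<in>K. cmod (indicator (\<Omega> - N) z *\<^sub>R D z v) \<le> B"
proof -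
  obtain \<delta> K' where K': "\<delta> > 0" "compact K'" "K' \<subseteq> \<Omega>" "\<And>x. x \<in> K \<Longrightarrow> cball x \<delta> \<subseteq> K'"
    using compact_neighbourhood[OF assms(1) open_dom assms(2)] by metis
  obtain L where L: "L-lipschitz_on K' g"
    using locally_lipschitz_compact[OF lip] K' by metis
  have "L \<ge> 0" using L by (rule lipschitz_on_nonneg)
  have v: "cmod v + 1 > 0" by (simp add: add_nonneg_pos)
  have "cmod (D z v) \<le> L * cmod v" if z: "z \<in> K" "z \<in> \<Omega> - N" for z
  proof (rule Lim_bounded)
    \<comment> \<open>Dividing by \<open>cmod v + 1\<close> keeps the displacement within
      \<open>\<delta>\<close>; the summand 1 covers v = 0.\<close>
    define t where "t n = \<delta> / (cmod v + 1) / Suc n" for n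
    have "t \<longlonglongrightarrow> 0"
      unfolding t_def using LIMSEQ_Suc[OF lim_const_over_n[of "\<delta> / (cmod v + 1)"]] by simp
    moreover have pos: "t n > 0" for n
      using \<open>\<delta> > 0\<close> v by (simp add: t_def)
    ultimately have t_lim: "filterlim t (at_right 0) sequentially"
      by (auto simp: filterlim_at intro!: always_eventually less_imp_neq[symmetric])
    show "(\<lambda>n. cmod ((g (z + t n *\<^sub>R v) - g z) /\<^sub>R t n)) \<longlonglongrightarrow> cmod (D z v)"
      using filterlim_compose[OF has_derivative_directional[OF deriv[OF z(2)]] t_lim]
      by (rule tendsto_norm)
    show "\<forall>n\<ge>0. cmod ((g (z + t n *\<^sub>R v) - g z) /\<^sub>R t n) \<le> L * cmod v"
    proof (intro allI impI)
      fix n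
      have "t n \<le> \<delta> / (cmod v + 1)"
        using \<open>\<delta> > 0\<close> v divide_left_mono[of 1 "real (Suc n)" "\<delta> / (cmod v + 1)"]
        by (simp add: t_def)
      then have "t n * cmod v \<le> \<delta> / (cmod v + 1) * cmod v"
        by (rule mult_right_mono) simp
      also have "\<dots> \<le> \<delta>"
        using \<open>\<delta> > 0\<close> v by (simp add: field_simps)
      finally have "z + t n *\<^sub>R v \<in> cball z \<delta>" "z \<in> cball z \<delta>"
        using pos[of n] \<open>\<delta> > 0\<close> by (simp_all add: dist_norm)
      then have "cmod (g (z + t n *\<^sub>R v) - g z) \<le> L * cmod (z + t n *\<^sub>R v - z)"
        using K'(4)[OF z(1)] by (intro lipschitz_on_normD[OF L]) auto
      then show "cmod ((g (z + t n *\<^sub>R v) - g z) /\<^sub>R t n) \<le> L * cmod v"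
        using pos[of n] by (simp add: divide_simps mult_ac)
    qed
  qed
  then have "\<forall>z\<in>K. cmod (indicator (\<Omega> - N) z *\<^sub>R D z v) \<le> L * cmod v"
    using \<open>L \<ge> 0\<close> by (auto simp: indicator_def)
  then show ?thesis by blast
qed

lemma bounded_function:
  assumes "compact K" and "K \<subseteq> \<Omega>"
  shows "\<exists>B. \<forall>z\<in>K. cmod (g z) \<le> B"
proof -
  have "continuous_on K g"
    using locally_lipschitz_imp_isCont[OF lip] assms
    by (auto intro!: continuous_at_imp_continuous_on)
  then have "bounded (g ` K)"
    using assms by (intro compact_imp_bounded compact_continuous_image)
  then show ?thesis by (auto simp: bounded_iff)
qed

text \<open>The product \<open>k\<close> of \<open>g\<close> with the test function vanishes outside
  a compact set and has directional derivative \<open>a z + b z\<close> almost everywhere, by the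
  product rule. That this derivative has integral zero is integration by parts.\<close>

lemma weak_partial_directional:
  "weak_partial \<Omega> v g (\<lambda>z. indicator (\<Omega> - N) z *\<^sub>R D z v)" (is "weak_partial _ _ _ ?P")
  unfolding weak_partial_def
proof (intro allI impI)
  fix u assume u: "test_fun \<Omega> u"
  define K where "K = closure {z. u z \<noteq> 0}"
  have K: "compact K" "K \<subseteq> \<Omega>" using u by (auto simp: test_fun_def K_def)
  have out: "u z = 0" if "z \<notin> K" for z
    using that closure_subset by (force simp: K_def)
  have dout: "frechet_derivative u (at z) v = 0" if "z \<notin> K" for z v
    using that by (simp add: K_def test_fun_derivative_outside)
  define g0 where "g0 z = indicator \<Omega> z *\<^sub>R g z" for z
  define k where "k z = g0 z * of_real (u z)" for z
  define a where "a z = ?P z * of_real (u z)" for z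
  define b where "b z = g0 z * of_real (frechet_derivative u (at z) v)" for z
  have [measurable]: "\<Omega> \<in> sets borel" "N \<in> sets borel"
    using open_dom closed_N by auto
  have [measurable]: "g0 \<in> borel_measurable borel"
    using borel_extension by (simp add: g0_def[abs_def])
  have [measurable]: "?P \<in> borel_measurable borel" by (rule borel_partial)
  have [measurable]: "u \<in> borel_measurable borel"
    "(\<lambda>z. frechet_derivative u (at z) v) \<in> borel_measurable borel"
    by (auto intro!: borel_measurable_continuous_onI test_fun_continuous[OF u]
        test_fun_continuous_derivative[OF u])
  obtain Bu where Bu: "Bu > 0" "\<And>z. norm (u z) \<le> Bu"
    using continuous_compact_support_bounded[OF test_fun_continuous[OF u] K(1) out] by metis
  obtain Bv where Bv: "Bv > 0" "\<And>z. norm (frechet_derivative u (at z) v) \<le> Bv"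
    using continuous_compact_support_bounded[OF test_fun_continuous_derivative[OF u] K(1) dout]
    by metis
  obtain \<delta>' K' where K': "\<delta>' > 0" "compact K'" "K' \<subseteq> \<Omega>" "\<And>x. x \<in> K \<Longrightarrow> cball x \<delta>' \<subseteq> K'"
    using compact_neighbourhood[OF K(1) open_dom K(2)] by metis
  then have "K \<subseteq> K'" by (meson centre_in_cball less_imp_le subsetD subsetI)
  obtain Lg where Lg: "Lg-lipschitz_on K' g"
    using locally_lipschitz_compact[OF lip] K' by metis
  obtain Lu where Lu: "Lu-lipschitz_on UNIV u"
    using test_fun_lipschitz[OF u] .
  obtain Bg where Bg: "\<And>z. z \<in> K' \<Longrightarrow> cmod (g z) \<le> Bg"
    using bounded_function[OF K'(2,3)] by blast
  obtain BP where BP: "\<And>z. z \<in> K \<Longrightarrow> cmod (?P z) \<le> BP"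
    using bounded_partial[OF K] by blast
  have g0_K': "g0 z = g z" if "z \<in> K'" for z
    using K'(3) that by (auto simp: g0_def)
  have [measurable]: "k \<in> borel_measurable borel" "a \<in> borel_measurable borel"
      "b \<in> borel_measurable borel"
    unfolding k_def[abs_def] a_def[abs_def] b_def[abs_def] by measurable
  have int_k: "integrable lborel k"
    using \<open>K \<subseteq> K'\<close> Bg Bu K(1) out g0_K'
    by (intro integrable_bounded_compact_support[where K = K and B = "Bg * Bu"])
      (auto simp: k_def norm_mult intro!: mult_mono' order.trans[OF _ Bg] simp flip: real_norm_def)
  have int_a: "integrable lborel a"
    using BP Bu K(1) out
    by (intro integrable_bounded_compact_support[where K = K and B = "BP * Bu"])
      (auto simp: a_def norm_mult intro!: mult_mono' simp del: norm_scaleR mult_scaleR_left simp flip: real_norm_def)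
  have int_b: "integrable lborel b"
    using \<open>K \<subseteq> K'\<close> Bg Bv K(1) dout g0_K'
    by (intro integrable_bounded_compact_support[where K = K and B = "Bg * Bv"])
      (auto simp: b_def norm_mult intro!: mult_mono' simp flip: real_norm_def)
  define \<delta> where "\<delta> = \<delta>' / (cmod v + 1)"
  have v: "cmod v + 1 > 0" by (simp add: add_nonneg_pos)
  have "\<delta> > 0" using K'(1) v by (simp add: \<delta>_def)
  have step: "t * cmod v \<le> \<delta>'" if "t \<le> \<delta>" for t
  proof -
    have "t * cmod v \<le> \<delta> * cmod v" using that by (rule mult_right_mono) simp
    also have "\<dots> \<le> \<delta>'"
      using K'(1) v by (simp add: \<delta>_def field_simps)
    finally show ?thesis .
  qed
  \<comment> \<open>A difference of \<open>k\<close> can be nonzero only if one endpoint lies in the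
    support \<open>K\<close>; then both endpoints lie in \<open>K'\<close>, where the Lipschitz
    bound for \<open>g\<close> holds.\<close>
  have near: "z \<in> K'" "z + t *\<^sub>R v \<in> K'"
    if "0 < t" "t \<le> \<delta>" "z \<in> K \<or> z + t *\<^sub>R v \<in> K" for z t
  proof -
    have "dist z (z + t *\<^sub>R v) \<le> \<delta>'"
      using step[OF that(2)] that(1) by (simp add: dist_norm)
    then have "z + t *\<^sub>R v \<in> cball z \<delta>'" "z \<in> cball (z + t *\<^sub>R v) \<delta>'"
      by (auto simp: dist_commute)
    then show "z \<in> K'" "z + t *\<^sub>R v \<in> K'"
      using that(3) K'(4) \<open>K \<subseteq> K'\<close> by blast+
  qed
  have "integral\<^sup>L lborel (\<lambda>z. a z + b z) = 0"
  proof (rule integral_directional_derivative_eq_0[OF int_k _ K'(2) \<open>\<delta> > 0\<close>])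
    show "(\<lambda>z. a z + b z) \<in> borel_measurable borel"
      unfolding a_def b_def by measurable
    show "k (z + t *\<^sub>R v) = k z" if "0 < t" "t \<le> \<delta>" "z \<notin> K'" for z t
    proof -
      have "z \<notin> K" "z + t *\<^sub>R v \<notin> K"
        using near[OF that(1,2), of z] that(3) by blast+
      then show ?thesis by (simp add: k_def out)
    qed
    show "norm (k (z + t *\<^sub>R v) - k z) \<le> ((\<bar>Bg\<bar> * Lu + Bu * Lg) * cmod v) * t"
      if t: "0 < t" "t \<le> \<delta>" and "z \<in> K'" for z t
    proof (cases "z \<in> K \<or> z + t *\<^sub>R v \<in> K")
      case True
      note mem = near[OF t True]
      let ?z = "z + t *\<^sub>R v"
      have "k ?z - k z = g ?z * of_real (u ?z - u z) + of_real (u z) * (g ?z - g z)"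
        using mem by (simp add: k_def g0_K' algebra_simps)
      also have "norm \<dots> \<le> cmod (g ?z) * norm (u ?z - u z) + norm (u z) * cmod (g ?z - g z)"
        by (intro norm_triangle_le) (simp add: norm_mult flip: of_real_diff)
      also have "\<dots> \<le> \<bar>Bg\<bar> * (Lu * norm (?z - z)) + Bu * (Lg * norm (?z - z))"
        using mem Bg[of ?z] Bu
        by (intro add_mono mult_mono lipschitz_on_normD[OF Lu] lipschitz_on_normD[OF Lg]) auto
      also have "norm (?z - z) = cmod v * t"
        using t by simp
      finally show ?thesis by (simp add: algebra_simps)
    next
      case False
      then show ?thesis
        using out t(1) Bu(1) lipschitz_on_nonneg[OF Lg] lipschitz_on_nonneg[OF Lu]
        by (simp add: k_def)
    qed
    show "AE z in lborel. ((\<lambda>t. (k (z + t *\<^sub>R v) - k z) /\<^sub>R t) \<longlongrightarrow> a z + b z) (at_right 0)"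
    proof (rule AE_I'[OF null_N], safe)
      fix z assume not: "\<not> ((\<lambda>t. (k (z + t *\<^sub>R v) - k z) /\<^sub>R t) \<longlongrightarrow> a z + b z) (at_right 0)"
      show "z \<in> N"
      proof (rule ccontr)
        assume "z \<notin> N"
        \<comment> \<open>Either the product rule applies, or \<open>k\<close> vanishes in a
          neighbourhood of \<open>z\<close>. Since \<open>K\<close> lies in \<open>\<Omega>\<close>,
          these cases cover the complement of \<open>N\<close>.\<close>
        consider "z \<in> \<Omega> - N" | "z \<notin> K" using \<open>z \<notin> N\<close> K(2) by blast
        then show False
        proof cases
          case 1
          have "(g0 has_derivative D z) (at z)"
            by (rule has_derivative_transform_within_open[OF deriv[OF 1] open_dom])
              (use 1 in \<open>auto simp: g0_def\<close>)
          moreover have "(u has_derivative frechet_derivative u (at z)) (at z)"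
            using test_fun_derivative[OF u] differentiableI frechet_derivative_works by blast
          ultimately have "(k has_derivative
              (\<lambda>w. g0 z * of_real (frechet_derivative u (at z) w) + D z w * of_real (u z))) (at z)"
            unfolding k_def[abs_def] by (intro has_derivative_mult has_derivative_of_real)
          from has_derivative_directional[OF this, of v] not 1 show False
            by (simp add: a_def b_def add.commute)
        next
          case 2
          have "(k has_derivative (\<lambda>_. 0)) (at z)"
          proof (rule has_derivative_transform_within_open[of "\<lambda>_. 0"])
            show "open (- K)" using K(1) by (simp add: compact_imp_closed open_Compl)
          qed (use 2 out in \<open>auto simp: k_def\<close>)
          from has_derivative_directional[OF this, of v] not 2 show False
            by (simp add: a_def b_def out dout)
        qed
      qed
    qed
  qed
  then have "integral\<^sup>L lborel a + integral\<^sup>L lborel b = 0"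
    using int_a int_b by simp
  moreover have "(LINT z:\<Omega>|lborel. g z * of_real (frechet_derivative u (at z) v))
      = integral\<^sup>L lborel b"
    unfolding set_lebesgue_integral_def by (simp add: b_def[abs_def] g0_def)
  moreover have "(LINT z:\<Omega>|lborel. ?P z * of_real (u z)) = integral\<^sup>L lborel a"
    unfolding set_lebesgue_integral_def
    by (intro Bochner_Integration.integral_cong) (auto simp: a_def indicator_def)
  ultimately show "(LINT z:\<Omega>|lborel. g z * of_real (frechet_derivative u (at z) v))
      = - (LINT z:\<Omega>|lborel. ?P z * of_real (u z))"
    by (simp add: eq_neg_iff_add_eq_0 add.commute)
qed

lemma W12_loc_with_derivative:
  "W12_loc_with \<Omega> g (\<lambda>z. indicator (\<Omega> - N) z *\<^sub>R D z 1) (\<lambda>z. indicator (\<Omega> - N) z *\<^sub>R D z \<i>)"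
proof -
  have "set_borel_measurable lborel \<Omega> (\<lambda>z. indicator (\<Omega> - N) z *\<^sub>R D z v)" for v
  proof -
    have "(\<lambda>z. indicator \<Omega> z *\<^sub>R indicator (\<Omega> - N) z *\<^sub>R D z v) = (\<lambda>z. indicator (\<Omega> - N) z *\<^sub>R D z v)"
      by (auto simp: fun_eq_iff indicator_def)
    then show ?thesis
      using borel_partial[of v] by (simp add: set_borel_measurable_def)
  qed
  then have "L2_loc \<Omega> (\<lambda>z. indicator (\<Omega> - N) z *\<^sub>R D z v)" for v
    using bounded_partial by (intro L2_loc_bounded)
  moreover have "L2_loc \<Omega> g"
    using bounded_function borel_extension
    by (intro L2_loc_bounded) (auto simp: set_borel_measurable_def)
  ultimately show ?thesis
    by (simp add: W12_loc_with_def weak_partial_directional)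
qed

end

section \<open>Small Lipschitz perturbations of complex affine maps\<close>

text \<open>A quantitative form of differentiability that holds for \<open>H\<close> at every point, including the
  unit circle where \<open>H\<close> may fail to be differentiable, and that determines the local degree.\<close>

definition near_conformal :: "(complex \<Rightarrow> complex) \<Rightarrow> complex \<Rightarrow> bool" where
  "near_conformal G z \<longleftrightarrow>
     (\<exists>A \<mu> e. 0 < e \<and> \<mu> < cmod A \<and> \<mu>-lipschitz_on (ball z e) (\<lambda>y. G y - A * y))"

lemma near_conformalI:
  assumes "0 < e" and "\<mu> < cmod A" and "\<mu>-lipschitz_on (ball z e) (\<lambda>y. G y - A * y)"
  shows "near_conformal G z"
  unfolding near_conformal_def using assms by blast

lemma near_conformalE:
  assumes "near_conformal G z"
  obtains A \<mu> e where "0 < e" "\<mu> < cmod A" "\<mu>-lipschitz_on (ball z e) (\<lambda>y. G y - A * y)"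
  using assms unfolding near_conformal_def by blast

lemma near_conformal_cong:
  assumes "near_conformal G z" and "open S" and "z \<in> S" and "\<And>y. y \<in> S \<Longrightarrow> G y = G' y"
  shows "near_conformal G' z"
proof -
  obtain A \<mu> e where *: "0 < e" "\<mu> < cmod A" "\<mu>-lipschitz_on (ball z e) (\<lambda>y. G y - A * y)"
    using assms(1) by (rule near_conformalE)
  obtain e' where "0 < e'" "ball z e' \<subseteq> S"
    using assms(2,3) open_contains_ball by blast
  then have "\<mu>-lipschitz_on (ball z (min e e')) (\<lambda>y. G' y - A * y)"
    using assms(4) by (intro lipschitz_on_transform[OF lipschitz_on_subset[OF *(3)]]) auto
  moreover have "0 < min e e'" using *(1) \<open>0 < e'\<close> by simp
  ultimately show ?thesis using *(2) by (intro near_conformalI)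
qed

text \<open>The derivative of the remainder is f'(w) - f'(z), which is small near \<open>z\<close>
  because f' is continuous; the mean value inequality on a ball does the rest.\<close>

lemma holomorphic_lipschitz_remainder:
  assumes "f holomorphic_on S" and "open S" and "z \<in> S" and "\<epsilon> > 0"
  obtains e where "e > 0" "ball z e \<subseteq> S" "\<epsilon>-lipschitz_on (ball z e) (\<lambda>y. f y - deriv f z * y)"
proof -
  have "continuous_on S (deriv f)"
    using assms by (intro holomorphic_on_imp_continuous_on holomorphic_deriv)
  then have "isCont (deriv f) z"
    using assms by (simp add: continuous_on_eq_continuous_at)
  then obtain d where d: "d > 0" "\<And>y. dist y z < d \<Longrightarrow> dist (deriv f y) (deriv f z) < \<epsilon>"
    using \<open>\<epsilon> > 0\<close> by (auto simp: continuous_at_eps_delta)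
  obtain e' where e': "e' > 0" "ball z e' \<subseteq> S"
    using assms(2,3) open_contains_ball by blast
  define e where "e = min d e'"
  have "\<epsilon>-lipschitz_on (ball z e) (\<lambda>y. f y - deriv f z * y)"
  proof (rule lipschitz_onI)
    fix x y assume xy: "x \<in> ball z e" "y \<in> ball z e"
    have "norm ((f x - deriv f z * x) - (f y - deriv f z * y)) \<le> \<epsilon> * norm (x - y)"
    proof (rule field_differentiable_bound[OF convex_ball _ _ xy])
      fix w assume w: "w \<in> ball z e"
      then have "(f has_field_derivative deriv f w) (at w)"
        using assms(1,2) e' by (intro holomorphic_derivI) (auto simp: e_def)
      then show "((\<lambda>y. f y - deriv f z * y) has_field_derivative (deriv f w - deriv f z))
          (at w within ball z e)"
        by (intro has_field_derivative_at_within[OF DERIV_diff] DERIV_cmult_Id)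
      show "norm (deriv f w - deriv f z) \<le> \<epsilon>"
        using d(2)[of w] w by (simp add: e_def dist_norm norm_minus_commute less_imp_le)
    qed
    then show "dist (f x - deriv f z * x) (f y - deriv f z * y) \<le> \<epsilon> * dist x y"
      by (simp add: dist_norm)
  qed (use \<open>\<epsilon> > 0\<close> in simp)
  moreover have "e > 0" "ball z e \<subseteq> S"
    using d e' by (auto simp: e_def)
  ultimately show ?thesis using that by blast
qed

lemma near_conformal_holomorphic:
  assumes "f holomorphic_on S" and "open S" and "z \<in> S" and "deriv f z \<noteq> 0"
  shows "near_conformal f z"
proof -
  have "cmod (deriv f z) / 2 > 0" using assms(4) by simp
  then obtain e where "e > 0" "ball z e \<subseteq> S"
    "(cmod (deriv f z) / 2)-lipschitz_on (ball z e) (\<lambda>y. f y - deriv f z * y)"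
    by (rule holomorphic_lipschitz_remainder[OF assms(1-3)])
  moreover have "cmod (deriv f z) / 2 < cmod (deriv f z)" using assms(4) by simp
  ultimately show ?thesis by (intro near_conformalI)
qed

lemma lipschitz_remainder_imp_lipschitz:
  assumes "\<mu>-lipschitz_on S (\<lambda>y. G y - A * y)"
  shows "(cmod A + \<mu>)-lipschitz_on S G"
proof (rule lipschitz_onI)
  fix x y assume "x \<in> S" "y \<in> S"
  from lipschitz_on_normD[OF assms this]
  have "cmod ((G x - A * x) - (G y - A * y)) \<le> \<mu> * cmod (x - y)" .
  moreover have "G x - G y = A * (x - y) + ((G x - A * x) - (G y - A * y))"
    by (simp add: algebra_simps)
  then have "cmod (G x - G y) \<le> cmod A * cmod (x - y) + cmod ((G x - A * x) - (G y - A * y))"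
    by (metis norm_mult norm_triangle_ineq[of "A * (x - y)"])
  ultimately show "dist (G x) (G y) \<le> (cmod A + \<mu>) * dist x y"
    by (simp add: dist_norm algebra_simps)
qed (use lipschitz_on_nonneg[OF assms] in simp)

text \<open>With c = f'(G z), the remainder f(G y) - c A y is the sum of f(G y) - c G y and c (G y -
  A y). The first has an arbitrarily small Lipschitz constant near \<open>z\<close>, the second has
  at most |c| \<open>\<mu>\<close> < |c A|.\<close>

lemma near_conformal_compose_left:
  assumes "near_conformal G z" and "f holomorphic_on S" and "open S" and "G z \<in> S"
    and "deriv f (G z) \<noteq> 0"
  shows "near_conformal (\<lambda>y. f (G y)) z"
proof -
  define c where "c = deriv f (G z)"
  obtain A \<mu> e where *: "0 < e" "\<mu> < cmod A" "\<mu>-lipschitz_on (ball z e) (\<lambda>y. G y - A * y)"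
    using assms(1) by (rule near_conformalE)
  define M where "M = cmod A + \<mu>"
  have "\<mu> \<ge> 0" using *(3) by (rule lipschitz_on_nonneg)
  then have "M > 0" using *(2) by (simp add: M_def)
  have G: "M-lipschitz_on (ball z e) G"
    unfolding M_def using *(3) by (rule lipschitz_remainder_imp_lipschitz)
  \<comment> \<open>The available slack is |c| (|A| - \<open>\<mu>\<close>); this choice lets the
    remainder of f, amplified by the Lipschitz constant \<open>M\<close> of \<open>G\<close>, use up
    half of it.\<close>
  define \<epsilon> where "\<epsilon> = cmod c * (cmod A - \<mu>) / (2 * M)"
  have c0: "cmod c * (cmod A - \<mu>) > 0"
    using *(2) assms(5) by (simp add: c_def)
  then have "\<epsilon> > 0"
    using \<open>M > 0\<close> by (simp add: \<epsilon>_def)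
  have small: "\<epsilon> * M + cmod c * \<mu> < cmod (c * A)"
  proof -
    have "\<epsilon> * M = cmod c * (cmod A - \<mu>) / 2" using \<open>M > 0\<close> by (simp add: \<epsilon>_def)
    then show ?thesis using c0 by (simp add: norm_mult algebra_simps)
  qed
  obtain d where d: "d > 0" "ball (G z) d \<subseteq> S" "\<epsilon>-lipschitz_on (ball (G z) d) (\<lambda>y. f y - c * y)"
    unfolding c_def by (rule holomorphic_lipschitz_remainder[OF assms(2-4) \<open>\<epsilon> > 0\<close>])
  define r where "r = min e (d / M)"
  have "r > 0" using d *(1) \<open>M > 0\<close> by (simp add: r_def)
  have into: "G y \<in> ball (G z) d" if "y \<in> ball z r" for y
  proof -
    have "dist (G z) (G y) \<le> M * dist z y"
      using that *(1) by (intro lipschitz_onD[OF G]) (auto simp: r_def)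
    also have "\<dots> < M * (d / M)"
      using that \<open>M > 0\<close> by (intro mult_strict_left_mono) (auto simp: r_def)
    finally show ?thesis using \<open>M > 0\<close> by simp
  qed
  have "(\<epsilon> * M + cmod c * \<mu>)-lipschitz_on (ball z r) (\<lambda>y. f (G y) - c * A * y)"
  proof (rule lipschitz_onI)
    fix x y assume xy: "x \<in> ball z r" "y \<in> ball z r"
    then have xy': "x \<in> ball z e" "y \<in> ball z e" by (auto simp: r_def)
    have "(f (G x) - c * A * x) - (f (G y) - c * A * y)
        = ((f (G x) - c * G x) - (f (G y) - c * G y)) + c * ((G x - A * x) - (G y - A * y))"
      by (simp add: algebra_simps)
    also have "cmod \<dots> \<le> cmod ((f (G x) - c * G x) - (f (G y) - c * G y))
        + cmod c * cmod ((G x - A * x) - (G y - A * y))"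
      by (rule order.trans[OF norm_triangle_ineq]) (simp add: norm_mult)
    also have "\<dots> \<le> \<epsilon> * (M * cmod (x - y)) + cmod c * (\<mu> * cmod (x - y))"
    proof (intro add_mono mult_left_mono)
      have "cmod ((f (G x) - c * G x) - (f (G y) - c * G y)) \<le> \<epsilon> * cmod (G x - G y)"
        using lipschitz_on_normD[OF d(3) into[OF xy(1)] into[OF xy(2)]] .
      also have "\<dots> \<le> \<epsilon> * (M * cmod (x - y))"
        using \<open>\<epsilon> > 0\<close> lipschitz_on_normD[OF G xy'] by simp
      finally show "cmod ((f (G x) - c * G x) - (f (G y) - c * G y)) \<le> \<epsilon> * (M * cmod (x - y))" .
    qed (use lipschitz_on_normD[OF *(3) xy'] in auto)
    finally show "dist (f (G x) - c * A * x) (f (G y) - c * A * y)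
        \<le> (\<epsilon> * M + cmod c * \<mu>) * dist x y"
      by (simp add: dist_norm algebra_simps)
  qed (use \<open>\<epsilon> > 0\<close> \<open>M > 0\<close> \<open>\<mu> \<ge> 0\<close> in simp)
  from near_conformalI[OF \<open>r > 0\<close> small this] show ?thesis .
qed

text \<open>With c = f'(z), the remainder G(f y) - A c y is the sum of G(f y) - A f y and A (f y - c
  y).\<close>

lemma near_conformal_compose_right:
  assumes "f holomorphic_on S" and "open S" and "z \<in> S" and "deriv f z \<noteq> 0"
    and "near_conformal G (f z)"
  shows "near_conformal (\<lambda>y. G (f y)) z"
proof -
  define c where "c = deriv f z"
  obtain A \<mu> e where *: "0 < e" "\<mu> < cmod A" "\<mu>-lipschitz_on (ball (f z) e) (\<lambda>y. G y - A * y)"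
    using assms(5) by (rule near_conformalE)
  have "\<mu> \<ge> 0" using *(3) by (rule lipschitz_on_nonneg)
  then have M: "\<mu> + cmod A > 0" using *(2) by simp
  \<comment> \<open>The Lipschitz constant of the sum is \<open>\<mu>\<close> |c| +
    (\<open>\<mu>\<close> + |A|) \<open>\<epsilon>\<close>; the second term is made half of the
    slack |c| (|A| - \<open>\<mu>\<close>).\<close>
  define \<epsilon> where "\<epsilon> = cmod c * (cmod A - \<mu>) / (2 * (\<mu> + cmod A))"
  have c0: "cmod c * (cmod A - \<mu>) > 0"
    using *(2) assms(4) by (simp add: c_def)
  then have "\<epsilon> > 0"
    using M by (simp add: \<epsilon>_def)
  have "\<epsilon> * (\<mu> + cmod A) < cmod c * (cmod A - \<mu>)"
  proof -
    have "\<epsilon> * (\<mu> + cmod A) = cmod c * (cmod A - \<mu>) / 2"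
      unfolding \<epsilon>_def using M by (subst mult_2) (simp add: field_simps)
    then show ?thesis using c0 by linarith
  qed
  then have small: "\<mu> * (cmod c + \<epsilon>) + cmod A * \<epsilon> < cmod (A * c)"
    by (simp add: norm_mult algebra_simps)
  obtain d where d: "d > 0" "ball z d \<subseteq> S" "\<epsilon>-lipschitz_on (ball z d) (\<lambda>y. f y - c * y)"
    unfolding c_def by (rule holomorphic_lipschitz_remainder[OF assms(1-3) \<open>\<epsilon> > 0\<close>])
  define M where "M = cmod c + \<epsilon>"
  have f: "M-lipschitz_on (ball z d) f"
    unfolding M_def using d(3) by (rule lipschitz_remainder_imp_lipschitz)
  have "M > 0" using \<open>\<epsilon> > 0\<close> by (simp add: M_def add_nonneg_pos)
  define r where "r = min d (e / M)"
  have "r > 0" using d *(1) \<open>M > 0\<close> by (simp add: r_def)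
  have into: "f y \<in> ball (f z) e" if "y \<in> ball z r" for y
  proof -
    have "dist (f z) (f y) \<le> M * dist z y"
      using that d(1) by (intro lipschitz_onD[OF f]) (auto simp: r_def)
    also have "\<dots> < M * (e / M)"
      using that \<open>M > 0\<close> by (intro mult_strict_left_mono) (auto simp: r_def)
    finally show ?thesis using \<open>M > 0\<close> by simp
  qed
  have "(\<mu> * (cmod c + \<epsilon>) + cmod A * \<epsilon>)-lipschitz_on (ball z r) (\<lambda>y. G (f y) - A * c * y)"
  proof (rule lipschitz_onI)
    fix x y assume xy: "x \<in> ball z r" "y \<in> ball z r"
    then have xy': "x \<in> ball z d" "y \<in> ball z d" by (auto simp: r_def)
    have "(G (f x) - A * c * x) - (G (f y) - A * c * y)
        = ((G (f x) - A * f x) - (G (f y) - A * f y)) + A * ((f x - c * x) - (f y - c * y))"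
      by (simp add: algebra_simps)
    also have "cmod \<dots> \<le> cmod ((G (f x) - A * f x) - (G (f y) - A * f y))
        + cmod A * cmod ((f x - c * x) - (f y - c * y))"
      by (rule order.trans[OF norm_triangle_ineq]) (simp add: norm_mult)
    also have "\<dots> \<le> \<mu> * (M * cmod (x - y)) + cmod A * (\<epsilon> * cmod (x - y))"
    proof (intro add_mono mult_left_mono)
      have "cmod ((G (f x) - A * f x) - (G (f y) - A * f y)) \<le> \<mu> * cmod (f x - f y)"
        using lipschitz_on_normD[OF *(3) into[OF xy(1)] into[OF xy(2)]] .
      also have "\<dots> \<le> \<mu> * (M * cmod (x - y))"
        using \<open>\<mu> \<ge> 0\<close> lipschitz_on_normD[OF f xy'] by (intro mult_left_mono)
      finally show "cmod ((G (f x) - A * f x) - (G (f y) - A * f y)) \<le> \<mu> * (M * cmod (x - y))" .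
    qed (use lipschitz_on_normD[OF d(3) xy'] in auto)
    finally show "dist (G (f x) - A * c * x) (G (f y) - A * c * y)
        \<le> (\<mu> * (cmod c + \<epsilon>) + cmod A * \<epsilon>) * dist x y"
      by (simp add: dist_norm M_def algebra_simps)
  qed (use \<open>\<epsilon> > 0\<close> \<open>\<mu> \<ge> 0\<close> in simp)
  from near_conformalI[OF \<open>r > 0\<close> small this] show ?thesis .
qed

lemma near_conformal_locally_lipschitz:
  assumes "\<And>z. z \<in> S \<Longrightarrow> near_conformal G z"
  shows "locally_lipschitz S G"
  unfolding locally_lipschitz_def
proof
  fix z assume "z \<in> S"
  then have "near_conformal G z" by (rule assms)
  then obtain A \<mu> e where "0 < e" "\<mu> < cmod A" "\<mu>-lipschitz_on (ball z e) (\<lambda>y. G y - A * y)"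
    by (rule near_conformalE)
  then show "\<exists>e>0. \<exists>L. L-lipschitz_on (ball z e) G"
    using lipschitz_remainder_imp_lipschitz by blast
qed

text \<open>The loop minus \<open>c\<close> is a constant times an exponential, so its logarithmic
  derivative is constantly 2 pi \<i>.\<close>

lemma winding_number_affine_circlepath:
  assumes "A \<noteq> 0" and "r > 0"
  shows "winding_number (\<lambda>t. c + A * (circlepath z r t - z)) c = 1"
proof -
  define \<gamma> where "\<gamma> = (\<lambda>t. c + A * (circlepath z r t - z))"
  have \<gamma>: "\<gamma> t = c + A * (of_real r * exp (2 * of_real pi * \<i> * of_real t))" for t
    by (simp add: \<gamma>_def circlepath)
  have vd: "(\<gamma> has_vector_derivative
      2 * of_real pi * \<i> * (\<gamma> t - c)) (at t within X)" for t X
    unfolding \<gamma>[abs_def]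
    by (auto intro!: derivative_eq_intros has_vector_derivative_real_field simp: mult_ac)
  have "valid_path \<gamma>"
    unfolding valid_path_def
  proof (rule C1_differentiable_imp_piecewise)
    have "continuous_on {0..1} (\<lambda>t. 2 * of_real pi * \<i> * (\<gamma> t - c))"
      unfolding \<gamma>[abs_def] by (intro continuous_intros)
    then show "\<gamma> C1_differentiable_on {0..1}"
      unfolding C1_differentiable_on_def
      by (intro exI[of _ "\<lambda>t. 2 * of_real pi * \<i> * (\<gamma> t - c)"]) (use vd in auto)
  qed
  moreover have ne: "\<gamma> t \<noteq> c" for t
    using assms by (simp add: \<gamma>)
  then have "c \<notin> path_image \<gamma>"
    by (auto simp: path_image_def)
  ultimately have "winding_number \<gamma> c = 1 / (2 * of_real pi * \<i>) * contour_integral \<gamma> (\<lambda>w. 1 / (w - c))"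
    by (simp add: winding_number_valid_path)
  also have "contour_integral \<gamma> (\<lambda>w. 1 / (w - c))
      = integral {0..1} (\<lambda>t. 1 / (\<gamma> t - c) * vector_derivative \<gamma> (at t))"
    by (simp add: contour_integral_integral)
  also have "\<dots> = integral {0..1::real} (\<lambda>t. 2 * of_real pi * \<i>)"
  proof (rule integral_cong)
    fix t :: real assume "t \<in> {0..1}"
    have "vector_derivative \<gamma> (at t) = 2 * of_real pi * \<i> * (\<gamma> t - c)"
      by (rule vector_derivative_at[OF vd])
    then show "1 / (\<gamma> t - c) * vector_derivative \<gamma> (at t) = 2 * of_real pi * \<i>"
      using ne[of t] by simp
  qed
  also have "\<dots> = 2 * of_real pi * \<i>" by simp
  finally show ?thesis by (simp add: \<gamma>_def)
qed

text \<open>On the circle of radius \<open>r\<close> the curve deviates from the affine loop by at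
  most \<open>\<mu>\<close> r, while that loop keeps distance |A| r > \<open>\<mu>\<close> r from
  \<open>G z\<close>. The segments joining the two curves therefore miss \<open>G z\<close>.\<close>

lemma near_conformal_winding_number:
  assumes "near_conformal G z"
  shows "\<forall>\<^sub>F r in at_right 0. winding_number (G \<circ> circlepath z r) (G z) = 1"
proof -
  obtain A \<mu> e where *: "0 < e" "\<mu> < cmod A" "\<mu>-lipschitz_on (ball z e) (\<lambda>y. G y - A * y)"
    using assms by (rule near_conformalE)
  have "A \<noteq> 0" using *(2) lipschitz_on_nonneg[OF *(3)] by auto
  have cont: "continuous_on (ball z e) G"
    using lipschitz_on_continuous_on[OF lipschitz_remainder_imp_lipschitz[OF *(3)]] .
  have "winding_number (G \<circ> circlepath z r) (G z) = 1" if r: "0 < r" "r < e" for r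
  proof -
    let ?p = "\<lambda>t. G z + A * (circlepath z r t - z)"
    have on: "cmod (circlepath z r t - z) = r" for t
      using r by (simp add: circlepath norm_mult)
    have in_ball: "circlepath z r t \<in> ball z e" for t
      using on[of t] r by (simp add: dist_norm norm_minus_commute)
    have "homotopic_loops (- {G z}) ?p (G \<circ> circlepath z r)"
    proof (rule homotopic_loops_nearby_explicit)
      show "path ?p"
        unfolding path_def circlepath by (intro continuous_intros)
      show "path (G \<circ> circlepath z r)"
        using in_ball by (intro path_continuous_image) (auto intro!: continuous_on_subset[OF cont] simp: path_image_def)
      show "pathfinish ?p = pathstart ?p" "pathfinish (G \<circ> circlepath z r) = pathstart (G \<circ> circlepath z r)"
        by (simp_all add: pathfinish_def pathstart_def circlepath)
      fix t :: real and x assume "x \<notin> - {G z}"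
      then have x: "x = G z" by simp
      have "cmod ((G (circlepath z r t) - A * circlepath z r t) - (G z - A * z)) \<le> \<mu> * r"
        using lipschitz_on_normD[OF *(3) in_ball[of t], of z] *(1) by (simp add: on)
      also have "\<dots> < cmod A * r" using *(2) r by simp
      finally have less: "cmod ((G (circlepath z r t) - A * circlepath z r t) - (G z - A * z))
        < cmod A * r" .
      show "cmod ((G \<circ> circlepath z r) t - ?p t) < cmod (?p t - x)"
      proof -
        have "cmod ((G \<circ> circlepath z r) t - ?p t)
            = cmod ((G (circlepath z r t) - A * circlepath z r t) - (G z - A * z))"
          by (rule arg_cong[of _ _ cmod]) (simp add: algebra_simps)
        moreover have "cmod (?p t - x) = cmod A * r"
          by (simp add: x norm_mult on)
        ultimately show ?thesis using less by linarith
      qed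
    qed
    from winding_number_homotopic_loops[OF this] show ?thesis
      using winding_number_affine_circlepath[OF \<open>A \<noteq> 0\<close> r(1)] by metis
  qed
  then show ?thesis
    unfolding eventually_at_right_field using *(1) by blast
qed

text \<open>\<open>a\<close> and \<open>b\<close> are the Wirtinger derivatives of \<open>G\<close>
  with respect to z and its conjugate.\<close>

definition dilatation_at :: "real \<Rightarrow> (complex \<Rightarrow> complex) \<Rightarrow> complex \<Rightarrow> bool" where
  "dilatation_at k G z \<longleftrightarrow>
     (\<exists>a b. (G has_derivative (\<lambda>v. a * v + b * cnj v)) (at z) \<and> cmod b \<le> k * cmod a)"

lemma dilatation_at_cong:
  assumes "dilatation_at k G z" and "open S" and "z \<in> S" and "\<And>y. y \<in> S \<Longrightarrow> G y = G' y"
  shows "dilatation_at k G' z"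
  using assms unfolding dilatation_at_def
  by (meson has_derivative_transform_within_open)

lemma dilatation_at_compose_left:
  assumes "dilatation_at k G z" and "(f has_field_derivative c) (at (G z))"
  shows "dilatation_at k (\<lambda>y. f (G y)) z"
proof -
  obtain a b where G: "(G has_derivative (\<lambda>v. a * v + b * cnj v)) (at z)" "cmod b \<le> k * cmod a"
    using assms(1) by (auto simp: dilatation_at_def)
  have "((\<lambda>y. f (G y)) has_derivative (\<lambda>v. c * (a * v + b * cnj v))) (at z)"
    using has_derivative_compose[OF G(1)] assms(2) by (simp add: has_field_derivative_def)
  moreover have "cmod (c * b) \<le> k * cmod (c * a)"
    using G(2) mult_left_mono[OF G(2), of "cmod c"] by (simp add: norm_mult mult_ac)
  ultimately show ?thesis
    unfolding dilatation_at_def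
    by (intro exI[of _ "c * a"] exI[of _ "c * b"]) (simp add: algebra_simps)
qed

text \<open>The coefficients become a c and b conj(c): both moduli scale by |c|, so a conformal
  change of coordinate preserves the inequality.\<close>

lemma dilatation_at_compose_right:
  assumes "(f has_field_derivative c) (at z)" and "dilatation_at k G (f z)"
  shows "dilatation_at k (\<lambda>y. G (f y)) z"
proof -
  obtain a b where G: "(G has_derivative (\<lambda>v. a * v + b * cnj v)) (at (f z))" "cmod b \<le> k * cmod a"
    using assms(2) by (auto simp: dilatation_at_def)
  have "((\<lambda>y. G (f y)) has_derivative (\<lambda>v. a * (c * v) + b * cnj (c * v))) (at z)"
    using has_derivative_compose[of f "\<lambda>v. c * v", OF _ G(1)] assms(1)
    by (simp add: has_field_derivative_def)
  moreover have "cmod (b * cnj c) \<le> k * cmod (a * c)"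
    using G(2) mult_left_mono[OF G(2), of "cmod c"] by (simp add: norm_mult mult_ac)
  ultimately show ?thesis
    unfolding dilatation_at_def
    by (intro exI[of _ "a * c"] exI[of _ "b * cnj c"]) (simp add: algebra_simps)
qed

lemma W12_dilatation_leI:
  assumes "open \<Omega>" and lip: "locally_lipschitz \<Omega> g"
    and N: "closed N" "N \<in> null_sets lborel"
    and dil: "\<And>z. z \<in> \<Omega> - N \<Longrightarrow> dilatation_at k g z"
  shows "W12_dilatation_le k \<Omega> g"
proof -
  obtain a b where ab: "\<And>z. z \<in> \<Omega> - N \<Longrightarrow> (g has_derivative (\<lambda>v. a z * v + b z * cnj v)) (at z)"
    "\<And>z. z \<in> \<Omega> - N \<Longrightarrow> cmod (b z) \<le> k * cmod (a z)"
    using dil unfolding dilatation_at_def by metis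
  \<comment> \<open>The partials of v \<mapsto> a v + b conj(v) are a + b and \<i> (a - b); their
    Wirtinger combinations give back \<open>a\<close> and \<open>b\<close>.\<close>
  let ?gx = "\<lambda>z. indicator (\<Omega> - N) z *\<^sub>R (a z * 1 + b z * cnj 1)"
  let ?gy = "\<lambda>z. indicator (\<Omega> - N) z *\<^sub>R (a z * \<i> + b z * cnj \<i>)"
  have "W12_loc_with \<Omega> g ?gx ?gy"
    using W12_loc_with_derivative[OF \<open>open \<Omega>\<close> lip N ab(1)] by simp
  moreover have "AE z in lborel. z \<in> \<Omega> \<longrightarrow>
      cmod ((?gx z + \<i> * ?gy z) / 2) \<le> k * cmod ((?gx z - \<i> * ?gy z) / 2)"
    using AE_not_in[OF N(2)]
  proof eventually_elim
    fix z assume "z \<notin> N"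
    show "z \<in> \<Omega> \<longrightarrow> cmod ((?gx z + \<i> * ?gy z) / 2) \<le> k * cmod ((?gx z - \<i> * ?gy z) / 2)"
    proof
      assume z: "z \<in> \<Omega>"
      with \<open>z \<notin> N\<close> have eq: "(?gx z + \<i> * ?gy z) / 2 = b z" "(?gx z - \<i> * ?gy z) / 2 = a z"
        by (simp_all add: algebra_simps)
      show "cmod ((?gx z + \<i> * ?gy z) / 2) \<le> k * cmod ((?gx z - \<i> * ?gy z) / 2)"
        unfolding eq using ab(2)[of z] z \<open>z \<notin> N\<close> by simp
    qed
  qed
  ultimately show ?thesis
    unfolding W12_dilatation_le_def by blast
qed

section \<open>Maps of the Riemann sphere in the two coordinates\<close>

text \<open>By Heine-Borel the compact complements of neighbourhoods of infinity are the closed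
  bounded sets, and closedness is already contained in the first conjunct.\<close>

lemma openin_riemann_sphere:
  "openin riemann_sphere W \<longleftrightarrow>
     open {z. Some z \<in> W} \<and> (None \<in> W \<longrightarrow> bounded {z. Some z \<notin> W})" (is "_ \<longleftrightarrow> ?R W")
proof
  assume "openin riemann_sphere W"
  then consider U where "open U" "W = Some ` U"
    | C where "compact C" "W = insert None (Some ` (UNIV - C))"
    by (auto simp: riemann_sphere_def openin_Alexandroff_compactification)
  then show "?R W"
  proof cases
    case 1
    then have "{z. Some z \<in> W} = U" by auto
    with 1 show ?thesis by auto
  next
    case 2
    then have "{z. Some z \<in> W} = - C" "{z. Some z \<notin> W} = C" by auto
    with 2 show ?thesis by (auto simp: compact_imp_closed compact_imp_bounded open_Compl)
  qed
next
  assume R: "?R W"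
  show "openin riemann_sphere W"
  proof (cases "None \<in> W")
    case True
    let ?C = "{z. Some z \<notin> W}"
    have "?C = - {z. Some z \<in> W}" by auto
    then have "compact ?C"
      using R True by (simp add: compact_eq_bounded_closed closed_Compl)
    moreover have "W = insert None (Some ` (UNIV - ?C))"
    proof (rule set_eqI)
      fix w show "w \<in> W \<longleftrightarrow> w \<in> insert None (Some ` (UNIV - ?C))"
        using True by (cases w) auto
    qed
    ultimately show ?thesis
      unfolding riemann_sphere_def openin_Alexandroff_compactification
      by (intro disjI2 exI[of _ ?C]) (auto simp: compact_imp_closed)
  next
    case False
    have "W = Some ` {z. Some z \<in> W}"
    proof (rule set_eqI)
      fix w show "w \<in> W \<longleftrightarrow> w \<in> Some ` {z. Some z \<in> W}"
        using False by (cases w) auto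
    qed
    with R show ?thesis
      unfolding riemann_sphere_def openin_Alexandroff_compactification by auto
  qed
qed

lemma topspace_riemann_sphere [simp]: "topspace riemann_sphere = UNIV"
  using topspace_Alexandroff_compactification[of "euclidean :: complex topology"]
  by (auto simp: riemann_sphere_def notin_range_Some)

lemma Hausdorff_riemann_sphere: "Hausdorff_space riemann_sphere"
  unfolding riemann_sphere_def Hausdorff_space_Alexandroff_compactification
  by (simp add: locally_compact_space_euclidean)

lemma compact_riemann_sphere: "compact_space riemann_sphere"
  by (simp add: riemann_sphere_def)

text \<open>A continuous bijection from a compact space to a Hausdorff space is a homeomorphism, so
  continuity of the inverse need not be checked.\<close>

lemma homeomorphic_map_riemann_sphereI:
  assumes "continuous_map riemann_sphere riemann_sphere F" and "bij F"
  shows "homeomorphic_map riemann_sphere riemann_sphere F"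
  using assms
  by (intro continuous_imp_homeomorphic_map)
    (auto simp: compact_riemann_sphere Hausdorff_riemann_sphere bij_def)

lemma sphere_inv_simps [simp]:
  "sphere_inv None = Some 0" "sphere_inv (Some 0) = None"
  "z \<noteq> 0 \<Longrightarrow> sphere_inv (Some z) = Some (inverse z)"
  by (simp_all add: sphere_inv_def)

lemma sphere_inv_involution [simp]: "sphere_inv (sphere_inv w) = w"
  by (cases w) (auto simp: sphere_inv_def)

lemma bij_sphere_inv: "bij sphere_inv"
  by (rule involuntory_imp_bij) simp

lemma continuous_sphere_inv: "continuous_map riemann_sphere riemann_sphere sphere_inv"
  unfolding continuous_map
proof (intro conjI allI impI)
  fix W assume W: "openin riemann_sphere W"
  let ?V = "{w \<in> topspace riemann_sphere. sphere_inv w \<in> W}"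
  define U where "U = {z. Some z \<in> W}"
  have "open U" using W by (simp add: openin_riemann_sphere U_def)
  let ?V' = "{z. sphere_inv (Some z) \<in> W}"
  have off_0: "open (?V' - {0})"
  proof -
    have "{z. sphere_inv (Some z) \<in> W} - {0} = - {0} \<inter> inverse -` U"
      by (auto simp: U_def)
    moreover have "open (- {0} \<inter> inverse -` U)"
      by (rule continuous_open_preimage) (auto intro!: continuous_intros \<open>open U\<close>)
    ultimately show ?thesis by simp
  qed
  \<comment> \<open>If \<open>W\<close> contains every point of modulus above \<open>B\<close>, its
    preimage contains the disk of radius 1 / B about 0.\<close>
  have at_0: "\<exists>e>0. ball 0 e \<subseteq> ?V'" if "None \<in> W"
  proof -
    have "bounded {z. Some z \<notin> W}" using W that by (simp add: openin_riemann_sphere)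
    then obtain B where B: "B > 0" "\<And>z. Some z \<notin> W \<Longrightarrow> cmod z \<le> B"
      by (auto simp: bounded_pos)
    have "sphere_inv (Some z) \<in> W" if "z \<in> ball 0 (1 / B)" for z
    proof (cases "z = 0")
      case False
      then have "cmod (inverse z) > B"
        using that B(1) by (simp add: norm_inverse norm_divide field_simps)
      then show ?thesis using B(2)[of "inverse z"] False by force
    qed (use \<open>None \<in> W\<close> in simp)
    then show ?thesis using B(1) by (intro exI[of _ "1 / B"]) auto
  qed
  have "open ?V'"
  proof (cases "None \<in> W")
    case True
    then obtain e where "e > 0" "ball 0 e \<subseteq> ?V'" using at_0 by blast
    then have "?V' = (?V' - {0}) \<union> ball 0 e" by auto
    then show ?thesis using off_0 by (metis open_Un open_ball)
  next
    case False
    then have "?V' = ?V' - {0}" by auto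
    then show ?thesis using off_0 by metis
  qed
  \<comment> \<open>The condition at \<open>None\<close>, which the inversion sends to
    \<open>Some 0\<close>: a disk of radius \<open>e\<close> about 0 pulls back to the exterior of
    the disk of radius 1 / e.\<close>
  moreover have "bounded {z. sphere_inv (Some z) \<notin> W}" if "Some 0 \<in> W"
  proof -
    have "0 \<in> U" using that by (simp add: U_def)
    then obtain e where e: "e > 0" "ball 0 e \<subseteq> U"
      using \<open>open U\<close> open_contains_ball by blast
    have "cmod z \<le> 1 / e" if "sphere_inv (Some z) \<notin> W" for z
    proof (rule ccontr)
      assume "\<not> cmod z \<le> 1 / e"
      then have "1 / e < cmod z" by simp
      moreover from this have "z \<noteq> 0" using e(1) by auto
      ultimately have "cmod (inverse z) < e" "z \<noteq> 0"
        using e(1) by (simp_all add: norm_divide inverse_eq_divide divide_less_eq mult.commute)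
      then show False using e(2) that by (auto simp: U_def)
    qed
    then show ?thesis unfolding bounded_iff by blast
  qed
  ultimately show "openin riemann_sphere ?V"
    by (simp add: openin_riemann_sphere)
qed simp

text \<open>The second hypothesis is properness, which is what continuity at \<open>None\<close>
  asks for.\<close>

lemma continuous_map_option:
  assumes "continuous_on UNIV H" and "\<And>B. bounded B \<Longrightarrow> bounded (H -` B)"
  shows "continuous_map riemann_sphere riemann_sphere (map_option H)"
  unfolding continuous_map
proof (intro conjI allI impI)
  fix W assume W: "openin riemann_sphere W"
  have "open (H -` {z. Some z \<in> W})"
    using W assms(1) by (intro open_vimage) (auto simp: openin_riemann_sphere)
  moreover have "bounded (H -` {z. Some z \<notin> W})" if "None \<in> W"
    using W that by (intro assms(2)) (simp add: openin_riemann_sphere)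
  ultimately show "openin riemann_sphere {w \<in> topspace riemann_sphere. map_option H w \<in> W}"
    by (simp add: openin_riemann_sphere vimage_def)
qed simp

lemma bij_map_option:
  assumes "bij H"
  shows "bij (map_option H)"
proof (rule o_bij)
  show "map_option (inv H) \<circ> map_option H = id"
    unfolding map_option.comp inv_o_cancel[OF bij_is_inj[OF assms]]
    by (rule option.map_id0)
  show "map_option H \<circ> map_option (inv H) = id"
    unfolding map_option.comp surj_iff[THEN iffD1, OF bij_is_surj[OF assms]]
    by (rule option.map_id0)
qed

lemma open_local_dom:
  assumes "continuous_map riemann_sphere riemann_sphere G"
  shows "open (local_dom G)"
proof -
  have "openin riemann_sphere (range Some)"
    by (simp add: openin_riemann_sphere)
  then have "openin riemann_sphere {w. G w \<in> range Some}"
    using assms unfolding continuous_map by fastforce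
  then have "open {z. G (Some z) \<in> range Some}"
    by (simp add: openin_riemann_sphere)
  moreover have "{z. G (Some z) \<in> range Some} = local_dom G"
    by (auto simp: local_dom_def image_iff)
  ultimately show ?thesis by simp
qed

text \<open>With this, the limit defining \<open>F_ext\<close> at \<open>None\<close> can be read
  off from continuity of a map on the sphere.\<close>

lemma tendsto_infinity_riemann_sphere: "limitin riemann_sphere Some None at_infinity"
  unfolding limitin_def
proof (intro conjI allI impI)
  fix U assume "openin riemann_sphere U \<and> None \<in> U"
  then have "bounded {z. Some z \<notin> U}" by (simp add: openin_riemann_sphere)
  then obtain B where B: "\<forall>z\<in>{z. Some z \<notin> U}. cmod z \<le> B"
    unfolding bounded_iff by blast
  have "Some z \<in> U" if "B + 1 \<le> cmod z" for z
  proof (rule ccontr)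
    assume "Some z \<notin> U"
    then have "cmod z \<le> B" using B by simp
    with that show False by simp
  qed
  then show "\<forall>\<^sub>F z in at_infinity. Some z \<in> U"
    unfolding eventually_at_infinity by blast
qed simp

text \<open>One exceptional set for all four charts: inversion preserves the unit circle, and 0 is
  the point that the source coordinate 1/z moves to infinity.\<close>

lemma null_insert_sphere: "insert 0 (sphere 0 1 :: complex set) \<in> null_sets lborel"
proof -
  have "(sphere 0 1 :: complex set) \<in> null_sets lborel"
    using negligible_sphere[of "0 :: complex" 1] null_sets_completion_iff[of "sphere 0 1" lborel]
    unfolding negligible_iff_null_sets by (metis borel_closed closed_sphere sets_lborel)
  moreover have "{0 :: complex} \<in> null_sets lborel"
    by (simp add: countable_imp_null_set_lborel)
  ultimately have "{0} \<union> sphere 0 1 \<in> null_sets (lborel :: complex measure)"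
    by (intro null_sets.Un)
  then show ?thesis by simp
qed

lemma deriv_inverse_nonzero: "z \<noteq> 0 \<Longrightarrow> deriv inverse z \<noteq> (0 :: complex)"
  by (simp add: DERIV_imp_deriv[OF DERIV_inverse])

text \<open>\<open>H\<close> is the sphere map in the coordinate 1/z on both sides.
  \<open>near_conformal_0\<close> is a separate assumption because it concerns the point that
  \<open>H\<close> sees only at infinity.\<close>

locale sphere_chart_map =
  fixes H :: "complex \<Rightarrow> complex" and k :: real
  assumes k: "0 \<le> k" "k < 1"
    and bij_H: "bij H"
    and proper_H: "\<And>B. bounded B \<Longrightarrow> bounded (H -` B)"
    and near_conformal_H: "\<And>w. near_conformal H w"
    and dilatation_H: "\<And>w. cmod w \<noteq> 1 \<Longrightarrow> dilatation_at k H w"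
    and near_conformal_0: "near_conformal (\<lambda>z. if z = 0 then 0 else inverse (H (inverse z))) 0"
begin

definition sphere_map :: "complex option \<Rightarrow> complex option" where
  "sphere_map = sphere_inv \<circ> map_option H \<circ> sphere_inv"

lemma continuous_H: "continuous_on UNIV H"
  using locally_lipschitz_imp_isCont[OF near_conformal_locally_lipschitz[of UNIV H]] near_conformal_H
  by (simp add: continuous_on_eq_continuous_at)

lemma continuous_extended_H: "continuous_map riemann_sphere riemann_sphere (map_option H)"
  using continuous_H proper_H by (rule continuous_map_option)

lemma continuous_sphere_map: "continuous_map riemann_sphere riemann_sphere sphere_map"
  unfolding sphere_map_def
  by (rule continuous_map_compose[OF continuous_sphere_inv
        continuous_map_compose[OF continuous_extended_H continuous_sphere_inv]])

lemma homeomorphic_sphere_map: "homeomorphic_map riemann_sphere riemann_sphere sphere_map"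
  by (intro homeomorphic_map_riemann_sphereI continuous_sphere_map)
    (simp add: sphere_map_def bij_comp bij_sphere_inv bij_map_option bij_H)

text \<open>\<open>g\<close> is an explicit formula agreeing with \<open>local_rep G\<close> where
  \<open>G\<close> is finite. That domain is open and the properties of \<open>g\<close> are local,
  so the arbitrary values of \<open>local_rep\<close> elsewhere do no harm.\<close>

lemma chart_quasiconformal:
  assumes cont: "continuous_map riemann_sphere riemann_sphere G"
    and near: "\<And>z. z \<in> local_dom G \<Longrightarrow> near_conformal g z"
    and dil: "\<And>z. \<lbrakk>z \<in> local_dom G; z \<noteq> 0; cmod z \<noteq> 1\<rbrakk> \<Longrightarrow> dilatation_at k g z"
    and rep: "\<And>z. z \<in> local_dom G \<Longrightarrow> G (Some z) = Some (g z)"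
  shows "sense_preserving_on (local_dom G) (local_rep G) \<and>
    W12_dilatation_le k (local_dom G) (local_rep G)"
proof -
  have op: "open (local_dom G)" using cont by (rule open_local_dom)
  have eq: "g z = local_rep G z" if "z \<in> local_dom G" for z
    using rep[OF that] by (simp add: local_rep_def)
  have near': "near_conformal (local_rep G) z" if "z \<in> local_dom G" for z
    by (rule near_conformal_cong[OF near[OF that] op that eq])
  have dil': "dilatation_at k (local_rep G) z" if "z \<in> local_dom G - insert 0 (sphere 0 1)" for z
    by (rule dilatation_at_cong[OF dil op _ eq]) (use that in auto)
  show ?thesis
  proof
    show "sense_preserving_on (local_dom G) (local_rep G)"
      unfolding sense_preserving_on_def using near_conformal_winding_number near' by blast
    show "W12_dilatation_le k (local_dom G) (local_rep G)"
      by (rule W12_dilatation_leI[OF op near_conformal_locally_lipschitz _ null_insert_sphere])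
        (use near' dil' in auto)
  qed
qed

lemma near_conformal_inverse_H: "H w \<noteq> 0 \<Longrightarrow> near_conformal (\<lambda>w. inverse (H w)) w"
  by (rule near_conformal_compose_left[OF near_conformal_H, where S = "- {0}"])
    (auto intro!: holomorphic_intros deriv_inverse_nonzero)

lemma near_conformal_H_inverse: "z \<noteq> 0 \<Longrightarrow> near_conformal (\<lambda>z. H (inverse z)) z"
  by (rule near_conformal_compose_right[OF _ _ _ _ near_conformal_H, where S = "- {0}"])
    (auto intro!: holomorphic_intros deriv_inverse_nonzero)

lemma near_conformal_inverse_H_inverse:
  assumes "z \<noteq> 0" and "H (inverse z) \<noteq> 0"
  shows "near_conformal (\<lambda>z. if z = 0 then 0 else inverse (H (inverse z))) z"
proof (rule near_conformal_cong[where S = "- {0}"])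
  show "near_conformal (\<lambda>z. inverse (H (inverse z))) z"
    by (rule near_conformal_compose_right[OF _ _ _ _ near_conformal_inverse_H, where S = "- {0}"])
      (use assms in \<open>auto intro!: holomorphic_intros deriv_inverse_nonzero\<close>)
qed (use assms in auto)

lemma dilatation_inverse_H: "\<lbrakk>cmod w \<noteq> 1; H w \<noteq> 0\<rbrakk> \<Longrightarrow> dilatation_at k (\<lambda>w. inverse (H w)) w"
  by (rule dilatation_at_compose_left[OF dilatation_H DERIV_inverse])

lemma dilatation_H_inverse: "\<lbrakk>cmod z \<noteq> 1; z \<noteq> 0\<rbrakk> \<Longrightarrow> dilatation_at k (\<lambda>z. H (inverse z)) z"
  by (rule dilatation_at_compose_right[OF DERIV_inverse dilatation_H]) (auto simp: norm_inverse)

lemma dilatation_inverse_H_inverse: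
  assumes "cmod z \<noteq> 1" and "z \<noteq> 0" and "H (inverse z) \<noteq> 0"
  shows "dilatation_at k (\<lambda>z. if z = 0 then 0 else inverse (H (inverse z))) z"
proof (rule dilatation_at_cong[where S = "- {0}"])
  show "dilatation_at k (\<lambda>z. inverse (H (inverse z))) z"
    by (rule dilatation_at_compose_right[OF DERIV_inverse dilatation_inverse_H])
      (use assms in \<open>auto simp: norm_inverse\<close>)
qed (use assms in auto)

theorem quasiconformal_sphere_map: "sphere_quasiconformal k sphere_map"
  unfolding sphere_quasiconformal_def
proof (intro conjI k homeomorphic_sphere_map ballI)
  fix S T :: "complex option \<Rightarrow> complex option"
  assume ST: "S \<in> {id, sphere_inv}" "T \<in> {id, sphere_inv}"
  let ?G = "T \<circ> sphere_map \<circ> S"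
  have "continuous_map riemann_sphere riemann_sphere S"
    "continuous_map riemann_sphere riemann_sphere T"
    using ST continuous_sphere_inv continuous_map_id[of riemann_sphere] by blast+
  then have cont: "continuous_map riemann_sphere riemann_sphere ?G"
    using continuous_map_compose[OF _ continuous_map_compose[OF continuous_sphere_map]] by blast
  have "sense_preserving_on (local_dom ?G) (local_rep ?G) \<and>
    W12_dilatation_le k (local_dom ?G) (local_rep ?G)"
  proof -
    consider "S = sphere_inv" "T = sphere_inv" | "S = sphere_inv" "T = id"
      | "S = id" "T = sphere_inv" | "S = id" "T = id" using ST by auto
    then show ?thesis
    proof cases
      case 1
      then have "?G = map_option H" by (simp add: sphere_map_def fun_eq_iff)
      then show ?thesis
        using cont by (intro chart_quasiconformal[where g = H])
          (auto intro: near_conformal_H dilatation_H)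
    next
      case 2
      then have G: "?G (Some z) = sphere_inv (Some (H z))" for z by (simp add: sphere_map_def)
      then have "local_dom ?G = {w. H w \<noteq> 0}"
        unfolding local_dom_def by (auto simp: sphere_inv_def)
      then show ?thesis
        using cont G by (intro chart_quasiconformal[where g = "\<lambda>w. inverse (H w)"])
          (auto intro: near_conformal_inverse_H dilatation_inverse_H simp: sphere_inv_def)
    next
      case 3
      then have G: "?G (Some z) = map_option H (sphere_inv (Some z))" for z
        by (simp add: sphere_map_def)
      then have "local_dom ?G = {z. z \<noteq> 0}"
        unfolding local_dom_def by (auto simp: sphere_inv_def)
      then show ?thesis
        using cont G by (intro chart_quasiconformal[where g = "\<lambda>z. H (inverse z)"])
          (auto intro: near_conformal_H_inverse dilatation_H_inverse simp: sphere_inv_def)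
    next
      case 4
      \<comment> \<open>This chart contains 0, which the map fixes. Degree and Lipschitz bound at 0
        come from \<open>near_conformal_0\<close>; for the dilatation, 0 belongs to the exceptional
        null set.\<close>
      then have G: "?G (Some z) = sphere_inv (map_option H (sphere_inv (Some z)))" for z
        by (simp add: sphere_map_def)
      then have "local_dom ?G = {z. z = 0 \<or> H (inverse z) \<noteq> 0}"
        unfolding local_dom_def by (auto simp: sphere_inv_def)
      then show ?thesis
        using cont G
        by (intro chart_quasiconformal[where g = "\<lambda>z. if z = 0 then 0 else inverse (H (inverse z))"])
          (auto intro: near_conformal_inverse_H_inverse dilatation_inverse_H_inverse
            near_conformal_0 simp: sphere_inv_def)
    qed
  qed
  then show "sense_preserving_on (local_dom ?G) (local_rep ?G)"
    "W12_dilatation_le k (local_dom ?G) (local_rep ?G)" by simp_all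
qed

end

section \<open>The Lipschitz remainder of 1/f\<close>

locale V_function =
  fixes p lambda :: real and f :: "complex \<Rightarrow> complex" and a :: "nat \<Rightarrow> complex"
  assumes p: "0 < p" "p < 1" and lambda: "0 < lambda" "lambda < 1"
    and class_V: "f \<in> class_V p lambda"
    and power_series: "\<And>z. cmod z < p \<Longrightarrow> (\<lambda>n. a (n + 2) * z ^ (n + 2)) sums (f z - z)"
begin

abbreviation disk :: "complex set" where "disk \<equiv> ball 0 1"

abbreviation pole :: complex where "pole \<equiv> of_real p"

lemma pole_props: "pole \<in> disk" "pole \<noteq> 0"
  using p by auto

lemma f_props: "f holomorphic_on (disk - {pole})" "is_pole f pole" "f 0 = 0" "deriv f 0 = 1"
  using class_V by (auto simp: class_V_def class_A_def)

lemma U_bound: "z \<in> disk \<Longrightarrow> cmod (U_op f z) < lambda"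
  using class_V by (auto simp: class_V_def)

lemma U_op_eq:
  assumes "z \<in> disk - {pole}" and "f z \<noteq> 0"
  shows "U_op f z = (z / f z)\<^sup>2 * deriv f z - 1"
  unfolding U_op_def
proof (rule remove_sings_at_analytic)
  let ?S = "{z \<in> disk - {pole}. f z \<noteq> 0}"
  have "?S = (disk - {pole}) \<inter> f -` (- {0})" by auto
  then have "open ?S"
    using holomorphic_on_imp_continuous_on[OF f_props(1)]
    by (metis continuous_open_preimage open_Compl closed_singleton open_ball open_Diff)
  moreover have "f holomorphic_on ?S" "deriv f holomorphic_on ?S"
    by (rule holomorphic_on_subset[OF f_props(1)] holomorphic_on_subset[OF holomorphic_deriv[OF f_props(1)]];
      auto)+
  then have "(\<lambda>z. (z / f z)\<^sup>2 * deriv f z - 1) holomorphic_on ?S"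
    by (auto intro!: holomorphic_intros)
  moreover have "z \<in> ?S" using assms by simp
  ultimately show "(\<lambda>z. (z / f z)\<^sup>2 * deriv f z - 1) analytic_on {z}"
    using analytic_at by blast
qed

lemma f_not_zero_everywhere: "\<exists>\<beta>\<in>disk - {pole}. f \<beta> \<noteq> 0"
proof (rule ccontr)
  assume "\<not> ?thesis"
  then have zero: "\<And>w. w \<in> disk - {pole} \<Longrightarrow> f w = 0" by blast
  have "\<forall>\<^sub>F w in nhds 0. w \<in> disk - {pole}"
    using pole_props by (intro eventually_nhds_in_open) auto
  then have "\<forall>\<^sub>F w in nhds 0. f w = 0"
    by eventually_elim (use zero in auto)
  then have "deriv f 0 = deriv (\<lambda>_. 0) 0" by (intro deriv_cong_ev) auto
  then show False using f_props(4) by simp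
qed

text \<open>At another zero the reciprocal of \<open>f\<close> would have a pole, and hence so would its derivative
  \<open>- (U + 1) / z\<^sup>2\<close>, which is bounded there.\<close>

lemma f_nonzero:
  assumes "z \<in> disk - {0, pole}"
  shows "f z \<noteq> 0"
proof
  assume zero: "f z = 0"
  have S: "open (disk - {pole})" "connected (disk - {pole})" "z \<in> disk - {pole}"
    using assms by (auto intro!: connected_open_delete)
  obtain \<beta> where "\<beta> \<in> disk - {pole}" "f \<beta> \<noteq> 0" using f_not_zero_everywhere by blast
  then have nz: "\<forall>\<^sub>F w in at z. f w \<noteq> 0 \<and> w \<in> disk - {pole}"
    by (rule non_zero_neighbour_alt[OF f_props(1) S])
  have an: "f analytic_on {z}"
    using f_props(1) S analytic_at by blast
  then have "f \<midarrow>z\<rightarrow> 0"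
    using zero analytic_at_imp_isCont[OF an] by (simp add: isCont_def)
  then have "filterlim f (at 0) (at z)"
    using nz by (auto simp: filterlim_at elim: eventually_mono)
  then have "is_pole (\<lambda>w. inverse (f w)) z"
    unfolding is_pole_def by (rule filterlim_compose[OF filterlim_inverse_at_infinity])
  moreover have "(\<lambda>w. inverse (f w)) meromorphic_on {z}"
    using an by (intro meromorphic_intros analytic_on_imp_meromorphic_on)
  ultimately have "is_pole (deriv (\<lambda>w. inverse (f w))) z"
    by (simp add: is_pole_deriv_iff)
  then have "filterlim (\<lambda>w. cmod (deriv (\<lambda>w. inverse (f w)) w)) at_top (at z)"
    unfolding is_pole_def by (rule filterlim_at_infinity_imp_norm_at_top)
  \<comment> \<open>The constant comes from |U + 1| \<le> 2 and |w| \<ge> |z| / 2, which give 2 /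
    (|z| / 2)^2.\<close>
  then have "\<forall>\<^sub>F w in at z. cmod (deriv (\<lambda>w. inverse (f w)) w) > 8 / (cmod z)\<^sup>2"
    by (simp add: filterlim_at_top_dense)
  moreover have "\<forall>\<^sub>F w in at z. cmod (deriv (\<lambda>w. inverse (f w)) w) \<le> 8 / (cmod z)\<^sup>2"
  proof -
    have "((\<lambda>w. cmod w) \<longlongrightarrow> cmod z) (at z)" by (intro tendsto_intros)
    then have "\<forall>\<^sub>F w in at z. cmod z / 2 < cmod w"
      using assms by (intro order_tendstoD(1)) auto
    with nz show ?thesis
    proof eventually_elim
      case (elim w)
      have "w \<noteq> 0" using elim(2) by auto
      have "(f has_field_derivative deriv f w) (at w)"
        using elim(1) f_props(1) S(1) by (intro holomorphic_derivI) auto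
      then have "deriv (\<lambda>w. inverse (f w)) w = - (deriv f w / (f w)\<^sup>2)"
        using elim(1) by (intro DERIV_imp_deriv)
          (auto intro!: derivative_eq_intros simp: power2_eq_square field_simps)
      also have "\<dots> = - (U_op f w + 1) / w\<^sup>2"
        using elim(1) \<open>w \<noteq> 0\<close> by (simp add: U_op_eq power_divide field_simps)
      finally have "cmod (deriv (\<lambda>w. inverse (f w)) w) = cmod (U_op f w + 1) / (cmod w)\<^sup>2"
        by (simp only: norm_divide norm_minus_cancel norm_power)
      also have "\<dots> \<le> 2 / (cmod z / 2)\<^sup>2"
      proof (rule frac_le)
        have "cmod (U_op f w + 1) \<le> cmod (U_op f w) + 1"
          using norm_triangle_ineq[of "U_op f w" 1] by simp
        then show "cmod (U_op f w + 1) \<le> 2"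
          using U_bound[of w] elim(1) lambda by simp
        show "(cmod z / 2)\<^sup>2 \<le> (cmod w)\<^sup>2"
          using elim(2) by (intro power_mono) auto
      qed (use assms in auto)
      finally show ?case by (simp add: power_divide)
    qed
  qed
  ultimately have "\<forall>\<^sub>F w in at z. False"
    by eventually_elim simp
  then show False by simp
qed

section \<open>The quotient z/f with its singularities removed, and the remainder psi\<close>

definition g :: "complex \<Rightarrow> complex" where
  "g = remove_sings (\<lambda>w. w / f w)"

lemma quotient_holomorphic: "(\<lambda>w. w / f w) holomorphic_on (disk - {0, pole})"
  using f_nonzero by (intro holomorphic_intros holomorphic_on_subset[OF f_props(1)]) auto

lemma quotient_tendsto_0: "(\<lambda>w. w / f w) \<midarrow>0\<rightarrow> 1"
proof -
  have "(f has_field_derivative deriv f 0) (at 0)"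
    using pole_props by (intro holomorphic_derivI[OF f_props(1)]) auto
  then have "(\<lambda>w. f w / w) \<midarrow>0\<rightarrow> 1"
    using f_props(3,4) by (simp add: has_field_derivative_iff)
  from tendsto_inverse[OF this] show ?thesis by simp
qed

lemma quotient_tendsto_pole: "(\<lambda>w. w / f w) \<midarrow>pole\<rightarrow> 0"
  using f_props(2) unfolding is_pole_def by (intro tendsto_divide_0) (auto intro: tendsto_intros)

lemma g_values: "g 0 = 1" "g pole = 0"
  unfolding g_def using quotient_tendsto_0 quotient_tendsto_pole by auto

lemma g_eq:
  assumes "z \<in> disk - {0, pole}"
  shows "g z = z / f z"
proof -
  have "open (disk - {0, pole})" by (intro open_Diff) auto
  then have "(\<lambda>w. w / f w) analytic_on {z}"
    using quotient_holomorphic assms analytic_at by blast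
  then show ?thesis by (simp add: g_def)
qed

lemma g_holomorphic: "g holomorphic_on disk"
proof -
  have "g analytic_on {z}" if "z \<in> disk" for z
  proof -
    \<comment> \<open>Only the exceptional points different from \<open>z\<close> are removed, so
      that one argument treats 0, the pole and all other points.\<close>
    have "open (disk - ({0, pole} - {z}))" by (intro open_Diff finite_imp_closed) auto
    moreover have "z \<in> disk - ({0, pole} - {z})" using that by simp
    ultimately obtain r where r: "r > 0" "ball z r \<subseteq> disk - ({0, pole} - {z})"
      by (rule openE)
    have "(\<lambda>w. w / f w) holomorphic_on (ball z r - {z})"
      by (rule holomorphic_on_subset[OF quotient_holomorphic]) (use r in auto)
    then have "isolated_singularity_at (\<lambda>w. w / f w) z"
      unfolding isolated_singularity_at_def using r(1)
      by (intro exI[of _ r]) (auto simp: analytic_on_open open_delete)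
    moreover have "\<exists>c. (\<lambda>w. w / f w) \<midarrow>z\<rightarrow> c"
    proof (cases "z \<in> {0, pole}")
      case True
      then show ?thesis using quotient_tendsto_0 quotient_tendsto_pole by auto
    next
      case False
      have "open (disk - {0, pole})" by (intro open_Diff) auto
      then have "isCont (\<lambda>w. w / f w) z"
        using holomorphic_on_imp_continuous_on[OF quotient_holomorphic] False that
        by (simp add: continuous_on_eq_continuous_at)
      then show ?thesis by (auto simp: isCont_def)
    qed
    ultimately show ?thesis
      unfolding g_def using remove_sings_analytic_at by blast
  qed
  then show ?thesis
    by (meson analytic_imp_holomorphic analytic_on_analytic_at)
qed

text \<open>With s(z) = (f(z) - z) / z^2, a power series with constant term \<open>a 2\<close>, the
  quotient (g(z) - 1) / z equals -s(z) * (z / f(z)) and z / f(z) tends to 1.\<close>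

lemma deriv_g_0: "(g has_field_derivative - a 2) (at 0)"
proof -
  define s where "s z = (if z = 0 then a 2 else (f z - z) / z\<^sup>2)" for z
  have "(\<lambda>n. a (n + 2) * z ^ n) sums s z" if "cmod z < p" for z
  proof (cases "z = 0")
    case True
    then show ?thesis using powser_sums_zero[of "\<lambda>n. a (n + 2)"]
      by (simp add: s_def numeral_2_eq_2)
  next
    case False
    have "(\<lambda>n. a (n + 2) * z ^ (n + 2) / z\<^sup>2) sums ((f z - z) / z\<^sup>2)"
      using power_series[OF that] by (rule sums_divide)
    moreover have "a (n + 2) * z ^ (n + 2) / z\<^sup>2 = a (n + 2) * z ^ n" for n
      using False by (simp add: power2_eq_square)
    ultimately show ?thesis using False by (simp only: s_def if_False)
  qed
  from powser_limit_0[OF p(1) this] have "s \<midarrow>0\<rightarrow> a 2" by (simp add: numeral_2_eq_2)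
  then have "(\<lambda>z. - s z * (z / f z)) \<midarrow>0\<rightarrow> - a 2 * 1"
    by (intro tendsto_intros quotient_tendsto_0)
  moreover have "\<forall>\<^sub>F z in at 0. - s z * (z / f z) = (g z - g 0) / (z - 0)"
  proof -
    have "\<forall>\<^sub>F z in at 0. z \<in> (disk - {pole}) - {0}"
      using pole_props by (intro eventually_at_in_open open_delete) auto
    then show ?thesis
    proof eventually_elim
      case (elim z)
      then have z: "z \<in> disk - {0, pole}" by auto
      from g_eq[OF z] f_nonzero[OF z] z show ?case
        by (simp add: s_def g_values power2_eq_square field_simps)
    qed
  qed
  ultimately have "(\<lambda>z. (g z - g 0) / (z - 0)) \<midarrow>0\<rightarrow> - a 2 * 1"
    by (rule Lim_transform_eventually)
  then show ?thesis by (simp add: has_field_derivative_iff)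
qed

lemma phi_eq: "phi f (a 2) = (\<lambda>z. g z + a 2 * z - 1)"
  by (simp add: phi_def g_def fun_eq_iff)

lemma phi_0: "phi f (a 2) 0 = 0"
  by (simp add: phi_eq g_values)

lemma DERIV_phi_0: "(phi f (a 2) has_field_derivative 0) (at 0)"
  unfolding phi_eq by (auto intro!: derivative_eq_intros deriv_g_0)

text \<open>The value at 0 removes the singularity, because phi and its derivative vanish
  there.\<close>

definition \<psi> :: "complex \<Rightarrow> complex" where
  "\<psi> z = (if z = 0 then 0 else phi f (a 2) z / z)"

lemma phi_eq_psi: "phi f (a 2) z = z * \<psi> z"
  by (simp add: \<psi>_def phi_0)

lemma psi_holomorphic: "\<psi> holomorphic_on disk"
proof -
  have "phi f (a 2) holomorphic_on disk"
    unfolding phi_eq by (intro holomorphic_intros g_holomorphic)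
  then have "(\<lambda>z. if z = 0 then deriv (phi f (a 2)) 0
      else (phi f (a 2) z - phi f (a 2) 0) / (z - 0)) holomorphic_on disk"
    by (rule pole_lemma) simp
  then show ?thesis
    unfolding \<psi>_def[abs_def] phi_0 DERIV_imp_deriv[OF DERIV_phi_0] diff_0_right .
qed

text \<open>Away from 0 and the pole \<open>\<psi>\<close> is 1/f + a 2 - 1/z, whose derivative is
  computed directly; the bound is useless near 0 and is improved in
  \<open>deriv_psi_bound\<close>.\<close>

lemma deriv_psi_bound_punctured:
  assumes "z \<in> disk - {0, pole}"
  shows "cmod (deriv \<psi> z) \<le> lambda / (cmod z)\<^sup>2"
proof -
  have op: "open (disk - {0, pole})" by (intro open_Diff) auto
  have "(f has_field_derivative deriv f z) (at z)"
    by (rule holomorphic_derivI[OF f_props(1)]) (use assms in auto)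
  then have "((\<lambda>w. 1 / f w + a 2 - 1 / w) has_field_derivative
      - (deriv f z / (f z)\<^sup>2) + 1 / z\<^sup>2) (at z)"
    using assms f_nonzero[OF assms]
    by (auto intro!: derivative_eq_intros simp: power2_eq_square field_simps)
  then have "(\<psi> has_field_derivative - (deriv f z / (f z)\<^sup>2) + 1 / z\<^sup>2) (at z)"
  proof (rule has_field_derivative_transform_within_open[OF _ op assms])
    fix w assume w: "w \<in> disk - {0, pole}"
    then show "1 / f w + a 2 - 1 / w = \<psi> w"
      using f_nonzero[OF w] by (auto simp: \<psi>_def phi_eq g_eq[OF w] field_simps)
  qed
  then have "deriv \<psi> z = - (deriv f z / (f z)\<^sup>2) + 1 / z\<^sup>2" by (rule DERIV_imp_deriv)
  also have "\<dots> = - U_op f z / z\<^sup>2"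
    using assms f_nonzero[OF assms] by (simp add: U_op_eq power_divide field_simps)
  finally have "cmod (deriv \<psi> z) = cmod (U_op f z) / (cmod z)\<^sup>2"
    by (simp add: norm_divide norm_power)
  then show ?thesis
    using U_bound[of z] assms by (simp add: divide_right_mono)
qed

lemma deriv_psi_bound:
  assumes "z \<in> disk"
  shows "cmod (deriv \<psi> z) \<le> lambda"
proof (rule tendsto_upperbound)
  \<comment> \<open>The bound lambda / r^2 from the circle of radius \<open>r\<close> is multiplied
    out before \<open>r\<close> tends to 1.\<close>
  show "((\<lambda>r. cmod (deriv \<psi> z) * r\<^sup>2) \<longlongrightarrow> cmod (deriv \<psi> z)) (at_left 1)"
    by (rule tendsto_eq_intros refl | simp)+
  \<comment> \<open>Beyond \<open>p\<close> the circle avoids both 0 and the pole; beyond |z| it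
    encloses \<open>z\<close>.\<close>
  have "\<forall>\<^sub>F r in at_left 1. r \<in> {max p (cmod z)<..<1}"
    using assms p by (intro eventually_at_leftI[of "max p (cmod z)"]) auto
  then show "\<forall>\<^sub>F r in at_left 1. cmod (deriv \<psi> z) * r\<^sup>2 \<le> lambda"
  proof eventually_elim
    case (elim r)
    then have r: "p < r" "cmod z < r" "r < 1" "0 < r" using p by auto
    have hol: "deriv \<psi> holomorphic_on disk"
      by (intro holomorphic_deriv psi_holomorphic) simp
    have "cmod (deriv \<psi> z) \<le> lambda / r\<^sup>2"
    proof (rule maximum_modulus_frontier[where f = "deriv \<psi>" and S = "cball 0 r"])
      show "deriv \<psi> holomorphic_on interior (cball 0 r)"
        using r by (intro holomorphic_on_subset[OF hol]) auto
      show "continuous_on (closure (cball 0 r)) (deriv \<psi>)"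
        using r by (intro holomorphic_on_imp_continuous_on holomorphic_on_subset[OF hol]) auto
      fix w :: complex assume "w \<in> frontier (cball 0 r)"
      then have w: "cmod w = r" using r by simp
      then have "w \<in> disk - {0, pole}" using r p by auto
      from deriv_psi_bound_punctured[OF this] show "cmod (deriv \<psi> w) \<le> lambda / r\<^sup>2"
        by (simp add: w)
    qed (use r in auto)
    then show ?case using r by (simp add: field_simps)
  qed
qed simp

lemma psi_lipschitz: "lambda-lipschitz_on disk \<psi>"
proof (rule lipschitz_onI)
  fix x y assume xy: "x \<in> disk" "y \<in> disk"
  have "cmod (\<psi> x - \<psi> y) \<le> lambda * cmod (x - y)"
  proof (rule field_differentiable_bound[OF convex_ball _ deriv_psi_bound xy])
    fix z assume "z \<in> disk"
    then show "(\<psi> has_field_derivative deriv \<psi> z) (at z within disk)"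
      by (intro has_field_derivative_at_within[OF holomorphic_derivI[OF psi_holomorphic]]) auto
  qed
  then show "dist (\<psi> x) (\<psi> y) \<le> lambda * dist x y" by (simp add: dist_norm)
qed (use lambda in simp)

text \<open>By density the extension is unique on the closed disk. Its values elsewhere are
  arbitrary and are never reached, since \<open>disk_fold\<close> maps into the closed disk.\<close>

definition \<Psi> :: "complex \<Rightarrow> complex" where
  "\<Psi> = (SOME h. lambda-lipschitz_on (cball 0 1) h \<and> (\<forall>z\<in>disk. h z = \<psi> z))"

lemma Psi_lipschitz: "lambda-lipschitz_on (cball 0 1) \<Psi>"
  and Psi_eq: "z \<in> disk \<Longrightarrow> \<Psi> z = \<psi> z"
proof -
  have "\<exists>h. lambda-lipschitz_on (cball 0 1) h \<and> (\<forall>z\<in>disk. h z = \<psi> z)"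
    using lipschitz_extend_closure[OF psi_lipschitz] by simp
  then have "lambda-lipschitz_on (cball 0 1) \<Psi> \<and> (\<forall>z\<in>disk. \<Psi> z = \<psi> z)"
    unfolding \<Psi>_def by (rule someI_ex)
  then show "lambda-lipschitz_on (cball 0 1) \<Psi>" "z \<in> disk \<Longrightarrow> \<Psi> z = \<psi> z" by auto
qed

lemma continuous_Psi: "continuous_on (cball 0 1) (\<lambda>z. z * \<Psi> z)"
  by (intro continuous_intros lipschitz_on_continuous_on[OF Psi_lipschitz])

lemma phi_bar_eq:
  assumes "z \<in> cball 0 1"
  shows "phi_bar f (a 2) z = z * \<Psi> z"
proof (cases "cmod z < 1")
  case True
  then show ?thesis by (simp add: phi_bar_def phi_eq_psi Psi_eq)
next
  case False
  have "((\<lambda>w. w * \<Psi> w) \<longlongrightarrow> z * \<Psi> z) (at z within disk)"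
    using continuous_Psi assms
    by (meson ball_subset_cball continuous_on_def tendsto_within_subset)
  moreover have "\<forall>\<^sub>F w in at z within disk. w * \<Psi> w = phi f (a 2) w"
    by (auto simp: eventually_at_filter Psi_eq phi_eq_psi)
  ultimately have "(phi f (a 2) \<longlongrightarrow> z * \<Psi> z) (at z within disk)"
    by (rule Lim_transform_eventually)
  \<comment> \<open>\<open>Lim\<close> picks out the limit only at a nontrivial filter; every point
    of the closed disk is a limit point of the open one.\<close>
  moreover have "\<not> trivial_limit (at z within disk)"
    using assms by (simp add: trivial_limit_within islimpt_ball)
  ultimately show ?thesis
    using False by (simp add: phi_bar_def tendsto_Lim)
qed

end

section \<open>The extension in the coordinates 1/z and 1/F\<close>

text \<open>For w = 1/z this is the point at which F evaluates phi: \<open>z\<close> itself when |z|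
  < 1, its reflection 1/conj(z) when |z| \<ge> 1. The value 0 at w = 0 belongs to z =
  infinity.\<close>

definition disk_fold :: "complex \<Rightarrow> complex" where
  "disk_fold w = (if cmod w \<le> 1 then cnj w else inverse w)"

lemma disk_fold_in_cball: "disk_fold w \<in> cball 0 1"
  by (auto simp: disk_fold_def norm_inverse inverse_le_1_iff)

text \<open>|conj(w) v - 1|^2 - |w - v|^2 = (1 - |w|^2)(1 - |v|^2), which is at most 0 when the unit
  circle separates the points; dividing by |v| > 1 only helps.\<close>

lemma dist_cnj_inverse_le:
  assumes "cmod w \<le> 1" and "1 < cmod v"
  shows "cmod (cnj w - inverse v) \<le> cmod (w - v)"
proof -
  have "v \<noteq> 0" using assms by auto
  have id: "(cmod (cnj w * v - 1))\<^sup>2 = (cmod (w - v))\<^sup>2 + (1 - (cmod w)\<^sup>2) * (1 - (cmod v)\<^sup>2)"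
    unfolding cmod_power2 by (simp add: power2_eq_square algebra_simps)
  have "(cmod w)\<^sup>2 \<le> 1" "1 \<le> (cmod v)\<^sup>2"
    using assms by (simp_all add: power_le_one one_le_power)
  then have "(1 - (cmod w)\<^sup>2) * (1 - (cmod v)\<^sup>2) \<le> 0"
    by (simp add: mult_nonneg_nonpos)
  with id have "(cmod (cnj w * v - 1))\<^sup>2 \<le> (cmod (w - v))\<^sup>2"
    by linarith
  then have "cmod (cnj w * v - 1) \<le> cmod (w - v)"
    by (rule power2_le_imp_le) simp
  moreover have "cnj w - inverse v = (cnj w * v - 1) / v"
    using \<open>v \<noteq> 0\<close> by (simp add: field_simps)
  then have "cmod (cnj w - inverse v) = cmod (cnj w * v - 1) / cmod v"
    by (simp add: norm_divide)
  moreover have "cmod (cnj w * v - 1) / cmod v \<le> cmod (cnj w * v - 1) / 1"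
    using assms by (intro divide_left_mono) auto
  ultimately show ?thesis by simp
qed

text \<open>Conjugation is an isometry, inversion outside the disk divides distances by |w| |v| > 1,
  and the mixed case is \<open>dist_cnj_inverse_le\<close>.\<close>

lemma disk_fold_lipschitz: "1-lipschitz_on UNIV disk_fold"
proof (rule lipschitz_onI)
  fix w v :: complex
  consider "cmod w \<le> 1" "cmod v \<le> 1" | "cmod w \<le> 1" "1 < cmod v"
    | "1 < cmod w" "cmod v \<le> 1" | "1 < cmod w" "1 < cmod v" by linarith
  then have "cmod (disk_fold w - disk_fold v) \<le> cmod (w - v)"
  proof cases
    case 1
    then show ?thesis
      by (simp add: disk_fold_def flip: complex_cnj_diff)
  next
    case 2
    then show ?thesis using dist_cnj_inverse_le[of w v] by (simp add: disk_fold_def)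
  next
    case 3
    then show ?thesis
      using dist_cnj_inverse_le[of v w] by (simp add: disk_fold_def norm_minus_commute)
  next
    case 4
    then have "w \<noteq> 0" "v \<noteq> 0" by auto
    then have "cmod (inverse w - inverse v) = cmod (w - v) / (cmod w * cmod v)"
      by (simp add: inverse_diff_inverse norm_mult norm_inverse divide_inverse mult_ac)
    also have "\<dots> \<le> cmod (w - v) / 1"
    proof (rule divide_left_mono)
      show "1 \<le> cmod w * cmod v" using 4 mult_mono[of 1 "cmod w" 1 "cmod v"] by simp
    qed (use \<open>w \<noteq> 0\<close> \<open>v \<noteq> 0\<close> in auto)
    finally show ?thesis using 4 by (simp add: disk_fold_def)
  qed
  then show "dist (disk_fold w) (disk_fold v) \<le> 1 * dist w v"
    by (simp add: dist_norm)
qed simp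

section \<open>The map H as a Lipschitz perturbation of the identity\<close>

context V_function
begin

definition H :: "complex \<Rightarrow> complex" where
  "H w = w - a 2 + \<Psi> (disk_fold w)"

lemma perturbation_lipschitz: "lambda-lipschitz_on UNIV (\<lambda>w. \<Psi> (disk_fold w))"
proof (rule lipschitz_onI)
  fix w v
  have "dist (\<Psi> (disk_fold w)) (\<Psi> (disk_fold v)) \<le> lambda * dist (disk_fold w) (disk_fold v)"
    by (intro lipschitz_onD[OF Psi_lipschitz] disk_fold_in_cball)
  also have "\<dots> \<le> lambda * dist w v"
    using lipschitz_onD[OF disk_fold_lipschitz, of w v] lambda by simp
  finally show "dist (\<Psi> (disk_fold w)) (\<Psi> (disk_fold v)) \<le> lambda * dist w v" .
qed (use lambda in simp)

lemma bij_H: "bij H"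
proof -
  have "\<exists>!w. H w = y" for y
  proof -
    \<comment> \<open>The equation H(w) = y in fixed point form; the right side is a
      lambda-contraction in w.\<close>
    have "\<exists>!w. y + a 2 - \<Psi> (disk_fold w) = w"
    proof (rule banach_fix_type[of lambda]; (intro allI)?)
      show "dist (y + a 2 - \<Psi> (disk_fold w)) (y + a 2 - \<Psi> (disk_fold v)) \<le> lambda * dist w v" for w v
        using lipschitz_onD[OF perturbation_lipschitz, of w v]
        by (simp add: dist_norm norm_minus_commute)
    qed (use lambda in auto)
    moreover have "y + a 2 - \<Psi> (disk_fold w) = w \<longleftrightarrow> H w = y" for w
      by (auto simp: H_def algebra_simps)
    ultimately show ?thesis by simp
  qed
  then show ?thesis unfolding bij_iff by blast
qed

text \<open>Subtracting the contraction leaves (1 - lambda) |w| \<le> |H(w) - H(0)|.\<close>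

lemma proper_H:
  assumes "bounded B"
  shows "bounded (H -` B)"
proof -
  obtain M where M: "\<forall>x\<in>B. cmod x \<le> M" using assms unfolding bounded_iff by blast
  have "cmod w \<le> (M + cmod (H 0)) / (1 - lambda)" if "w \<in> H -` B" for w
  proof -
    have "cmod (\<Psi> (disk_fold w) - \<Psi> (disk_fold 0)) \<le> lambda * cmod w"
      using lipschitz_on_normD[OF perturbation_lipschitz, of w 0] by simp
    moreover have "w = (H w - H 0) - (\<Psi> (disk_fold w) - \<Psi> (disk_fold 0))"
      by (simp add: H_def)
    then have "cmod w \<le> cmod (H w - H 0) + cmod (\<Psi> (disk_fold w) - \<Psi> (disk_fold 0))"
      by (metis norm_triangle_ineq4)
    moreover have "cmod (H w - H 0) \<le> cmod (H w) + cmod (H 0)"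
      by (rule norm_triangle_ineq4)
    moreover have "cmod (H w) \<le> M" using M that by auto
    ultimately have "(1 - lambda) * cmod w \<le> M + cmod (H 0)"
      by (simp add: algebra_simps)
    then show ?thesis using lambda by (simp add: field_simps)
  qed
  then show ?thesis unfolding bounded_iff by blast
qed

lemma near_conformal_H: "near_conformal H w"
proof (rule near_conformalI)
  show "lambda-lipschitz_on (ball w 1) (\<lambda>y. H y - 1 * y)"
  proof (rule lipschitz_onI)
    fix x y
    show "dist (H x - 1 * x) (H y - 1 * y) \<le> lambda * dist x y"
      using lipschitz_onD[OF perturbation_lipschitz, of x y]
      by (simp add: H_def dist_norm)
  qed (use lambda in simp)
qed (use lambda in auto)

lemma psi_derivative:
  assumes "z \<in> disk"
  shows "(\<psi> has_derivative (\<lambda>v. deriv \<psi> z * v)) (at z)"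
  using holomorphic_derivI[OF psi_holomorphic open_ball assms]
  by (simp add: has_field_derivative_def)

text \<open>For |w| < 1 the Wirtinger derivatives are 1 and psi'(conj w), so the bound on psi' is
  the dilatation bound; for |w| > 1 the map is holomorphic.\<close>

lemma dilatation_H:
  assumes "cmod w \<noteq> 1"
  shows "dilatation_at lambda H w"
proof (cases "cmod w < 1")
  case True
  have "(cnj has_derivative cnj) (at w)"
    by (rule bounded_linear_imp_has_derivative[OF bounded_linear_cnj])
  moreover have "(\<psi> has_derivative (\<lambda>v. deriv \<psi> (cnj w) * v)) (at (cnj w))"
    using True by (intro psi_derivative) simp
  ultimately have "((\<lambda>y. \<psi> (cnj y)) has_derivative (\<lambda>v. deriv \<psi> (cnj w) * cnj v)) (at w)"
    by (rule has_derivative_compose)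
  then have "((\<lambda>y. y - a 2 + \<psi> (cnj y)) has_derivative
      (\<lambda>v. 1 * v + deriv \<psi> (cnj w) * cnj v)) (at w)"
    by (auto intro!: derivative_eq_intros)
  moreover have "cmod (deriv \<psi> (cnj w)) \<le> lambda * cmod 1"
    using deriv_psi_bound[of "cnj w"] True by simp
  ultimately have "dilatation_at lambda (\<lambda>y. y - a 2 + \<psi> (cnj y)) w"
    unfolding dilatation_at_def by blast
  then show ?thesis
    by (rule dilatation_at_cong[where S = disk])
      (use True in \<open>auto simp: H_def disk_fold_def Psi_eq\<close>)
next
  case False
  then have w: "cmod w > 1" using assms by simp
  then have w0: "w \<noteq> 0" by auto
  have in_disk: "inverse w \<in> disk"
    using w by (simp add: norm_inverse inverse_le_1_iff inverse_less_1_iff one_less_inverse_iff)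
  have "((\<lambda>y. \<psi> (inverse y)) has_field_derivative
      deriv \<psi> (inverse w) * - (inverse w ^ Suc (Suc 0))) (at w)"
    by (rule DERIV_chain2[OF holomorphic_derivI[OF psi_holomorphic open_ball in_disk]
          DERIV_inverse[OF w0]])
  then have "((\<lambda>y. y - a 2 + \<psi> (inverse y)) has_field_derivative
      1 + deriv \<psi> (inverse w) * - (inverse w ^ Suc (Suc 0))) (at w)"
    by (auto intro!: derivative_eq_intros)
  then have "((\<lambda>y. y - a 2 + \<psi> (inverse y)) has_derivative
      (\<lambda>v. (1 + deriv \<psi> (inverse w) * - (inverse w ^ Suc (Suc 0))) * v + 0 * cnj v)) (at w)"
    by (simp add: has_field_derivative_def)
  then have "dilatation_at lambda (\<lambda>y. y - a 2 + \<psi> (inverse y)) w"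
    unfolding dilatation_at_def using lambda
    by (intro exI[of _ "1 + deriv \<psi> (inverse w) * - (inverse w ^ Suc (Suc 0))"] exI[of _ 0]) auto
  then show ?thesis
  proof (rule dilatation_at_cong[where S = "- cball 0 1"])
    fix y :: complex assume "y \<in> - cball 0 1"
    then have y: "cmod y > 1" by simp
    then have "inverse y \<in> disk"
      by (simp add: norm_inverse inverse_le_1_iff inverse_less_1_iff one_less_inverse_iff)
    then show "y - a 2 + \<psi> (inverse y) = H y"
      using y by (simp add: H_def disk_fold_def Psi_eq)
  qed (use w in auto)
qed

text \<open>Away from the pole the right side is 1/f(z); written with \<open>g\<close> it is also
  correct at the pole, where \<open>f\<close> has an arbitrary value.\<close>

lemma H_inverse:
  assumes "z \<in> disk" and "z \<noteq> 0"
  shows "H (inverse z) = g z / z"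
proof -
  have "cmod (inverse z) > 1"
    using assms by (simp add: norm_inverse inverse_le_1_iff inverse_less_1_iff one_less_inverse_iff)
  then have "H (inverse z) = inverse z - a 2 + \<psi> z"
    using assms by (simp add: H_def disk_fold_def Psi_eq)
  also have "\<dots> = g z / z"
    using assms(2) by (simp add: \<psi>_def phi_eq field_simps)
  finally show ?thesis .
qed

text \<open>Near 0 the map is z / g(z), holomorphic with derivative 1 / g(0) = 1.\<close>

lemma near_conformal_0: "near_conformal (\<lambda>z. if z = 0 then 0 else inverse (H (inverse z))) 0"
proof (rule near_conformal_cong)
  let ?S = "disk \<inter> g -` (- {0})"
  show op: "open ?S"
    by (intro continuous_open_preimage holomorphic_on_imp_continuous_on g_holomorphic) auto
  show "0 \<in> ?S" by (simp add: g_values)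
  show "near_conformal (\<lambda>z. z / g z) 0"
  proof (rule near_conformal_holomorphic[OF _ op \<open>0 \<in> ?S\<close>])
    show "(\<lambda>z. z / g z) holomorphic_on ?S"
      by (intro holomorphic_intros holomorphic_on_subset[OF g_holomorphic]) auto
    have "((\<lambda>z. z / g z) has_field_derivative 1) (at 0)"
      by (auto intro!: derivative_eq_intros deriv_g_0 simp: g_values)
    then show "deriv (\<lambda>z. z / g z) 0 \<noteq> 0" by (simp add: DERIV_imp_deriv)
  qed
  show "z / g z = (if z = 0 then 0 else inverse (H (inverse z)))" if "z \<in> ?S" for z
    using that H_inverse[of z] by simp
qed

sublocale sphere_chart_map H lambda
  using lambda bij_H proper_H near_conformal_H dilatation_H near_conformal_0
  by unfold_locales auto

section \<open>Identification of the explicit formula with the chart map\<close>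

lemma F_fin_disk: "z \<in> disk \<Longrightarrow> F_fin f (a 2) z = sphere_div z (g z)"
  by (simp add: F_fin_def phi_eq)

lemma sphere_inv_eq_sphere_div: "z \<noteq> 0 \<Longrightarrow> sphere_inv (Some h) = sphere_div z (z * h)"
  by (simp add: sphere_inv_def sphere_div_def field_simps)

lemma F_fin_eq: "F_fin f (a 2) z = sphere_map (Some z)"
proof (cases "z = 0")
  case True
  then show ?thesis
    using F_fin_disk[of 0] by (simp add: sphere_map_def g_values sphere_div_def)
next
  case False
  have "F_fin f (a 2) z = sphere_div z (z * H (inverse z))"
  proof (cases "cmod z < 1")
    case True
    then show ?thesis using False F_fin_disk[of z] H_inverse[of z] by simp
  next
    case ge: False
    then have le: "cmod (inverse z) \<le> 1"
      by (simp add: norm_inverse inverse_le_1_iff inverse_less_1_iff one_less_inverse_iff)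
    then have "H (inverse z) = inverse z - a 2 + \<Psi> (1 / cnj z)"
      by (simp add: H_def disk_fold_def inverse_eq_divide)
    moreover have "phi_bar f (a 2) (1 / cnj z) = 1 / cnj z * \<Psi> (1 / cnj z)"
      using le by (intro phi_bar_eq) (simp add: norm_divide norm_inverse inverse_eq_divide)
    \<comment> \<open>The factor |z|^2 = z conj(z) absorbs the zero 1/conj(z) that phi carries and
      leaves \<open>z\<close>, the same factor as inside the disk.\<close>
    moreover have "of_real ((cmod z)\<^sup>2) * (1 / cnj z) = z"
      using False by (simp add: complex_norm_square del: of_real_power)
    ultimately have "of_real ((cmod z)\<^sup>2) * phi_bar f (a 2) (1 / cnj z) = z * \<Psi> (1 / cnj z)"
      "z * H (inverse z) = 1 - a 2 * z + z * \<Psi> (1 / cnj z)"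
      using False by (simp_all only: mult.assoc[symmetric]) (simp add: algebra_simps)
    then show ?thesis using ge by (simp only: F_fin_def if_False)
  qed
  then show ?thesis
    using False by (simp add: sphere_map_def sphere_inv_eq_sphere_div[OF False, of "H (inverse z)"])
qed

text \<open>Continuity of \<open>sphere_map\<close> at \<open>None\<close> supplies the limit at
  infinity, and the Hausdorff property makes it the only one, so that \<open>THE\<close> selects
  it.\<close>

lemma F_ext_eq: "F_ext f (a 2) = sphere_map"
proof
  fix w
  show "F_ext f (a 2) w = sphere_map w"
  proof (cases w)
    case None
    have "F_fin f (a 2) = sphere_map \<circ> Some"
      by (simp add: fun_eq_iff F_fin_eq)
    then have lim: "limitin riemann_sphere (F_fin f (a 2)) (sphere_map None) at_infinity"
      using continuous_map_limit[OF continuous_sphere_map tendsto_infinity_riemann_sphere] by simp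
    have "(THE l. limitin riemann_sphere (F_fin f (a 2)) l at_infinity) = sphere_map None"
    proof (rule the_equality)
      show "l = sphere_map None" if "limitin riemann_sphere (F_fin f (a 2)) l at_infinity" for l
        using that lim trivial_limit_at_infinity Hausdorff_riemann_sphere
        by (rule limitin_Hausdorff_unique)
    qed (rule lim)
    then show ?thesis by (simp add: F_ext_def None)
  qed (simp add: F_ext_def F_fin_eq)
qed

lemma F_fin_extends:
  assumes "z \<in> disk"
  shows "F_fin f (a 2) z = to_sphere f z"
proof (cases "z = pole")
  case True
  \<comment> \<open>At the pole \<open>g\<close> vanishes, so \<open>sphere_div\<close> returns
    \<open>None\<close> there, in agreement with \<open>to_sphere\<close>.\<close>
  then show ?thesis
    using F_fin_disk[OF assms] f_props(2) by (simp add: to_sphere_def g_values sphere_div_def)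
next
  case False
  have "open (disk - {pole})" by auto
  then have "\<not> is_pole f z"
    using False assms f_props(1) by (intro not_is_pole_holomorphic[of "disk - {pole}"]) auto
  moreover have "sphere_div z (g z) = Some (f z)"
  proof (cases "z = 0")
    case True
    then show ?thesis by (simp add: g_values f_props(3) sphere_div_def)
  next
    case nz: False
    with False assms have z: "z \<in> disk - {0, pole}" by simp
    show ?thesis
      using g_eq[OF z] f_nonzero[OF z] nz by (simp add: sphere_div_def)
  qed
  ultimately show ?thesis
    using F_fin_disk[OF assms] by (simp add: to_sphere_def)
qed

lemma qc_extension: "is_qc_extension lambda f (F_ext f (a 2))"
  unfolding is_qc_extension_def F_ext_eq
  using quasiconformal_sphere_map F_fin_extends by (simp add: F_fin_eq)

lemma continuous_phi_bar: "continuous_on (cball 0 1) (phi_bar f (a 2))"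
  using continuous_Psi phi_bar_eq by (subst continuous_on_cong[OF refl]) auto

end

theorem theorem3:
  fixes p lambda :: real and f :: "complex \<Rightarrow> complex" and a :: "nat \<Rightarrow> complex"
  assumes "0 < p" and "p < 1" and "0 < lambda" and "lambda < 1"
    and "f \<in> class_V p lambda"
    and "\<And>z. cmod z < p \<Longrightarrow> (\<lambda>n. a (n + 2) * z ^ (n + 2)) sums (f z - z)"
    and "\<exists>z\<in>ball 0 1. U_op f z \<noteq> 0"
  shows "phi f (a 2) 0 = 0 \<and> deriv (phi f (a 2)) 0 = 0 \<and>
         continuous_on (cball 0 1) (phi_bar f (a 2)) \<and>
         is_qc_extension lambda f (F_ext f (a 2))"
proof -
  interpret V_function p lambda f a
    by unfold_locales (use assms in auto)
  show ?thesis
    using phi_0 DERIV_imp_deriv[OF DERIV_phi_0] continuous_phi_bar qc_extension by blast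
qed

end
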